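(* For each $k\ge1$, $k$DDSOS programming is equivalent to $(\mathbb{S}^d_+)_k$ cone programming (the $k$th order cone programming induced by the positive semidefinite cone): every $k$DDSOS program can be cast into an $(\mathbb{S}^d_+)_k$ cone program for some $d$, and every $(\mathbb{S}^d_+)_k$ cone program can be cast into a $k$DDSOS program.
   Context: For $n,d\ge1$ put $N=\binom{n+d}{d}$ and let $m_1,\dots,m_N$ be all monomials in $n$ variables of degree at most $d$. A polynomial $p$ is $k$DDSOS if it can be written as a finite sum $p=\sum_{i_1,\dots,i_k}\sum_j(\sum_{l=1}^k\alpha^{i_1\cdots i_k}_{ji_l}m_{i_l})^2$ over tuples $(i_1,\dots,i_k)\in\{1,\dots,N\}^k$ (not required to be increasing or distinct) and finitely many $j$, with real constants $\alpha$. Let $k\mathsf{SOS}_{n,d}$ denote the cone of $k$DDSOS polynomials in $n$ variables of degree at most $2d$. A $k$DDSOS program is: minimize $r^{\mathsf T}u$ over $u\in\mathbb{R}^l$ subject to $r_{0,t}(x)+r_{1,t}(x)u_1+\dots+r_{l,t}(x)u_l\in k\mathsf{SOS}_{n_t,d_t}$ for $t=1,\dots,T$, where $r\in\mathbb{R}^l$ and the $r_{i,t}$ are given real polynomials (possibly zero) in $n_t$ variables of degree at most $2d_t$, with $n_t,d_t\ge1$. $\mathbb{S}^d$ is the space of real symmetric $d\times d$ matrices, $\mathbb{S}^k_+$ the cone of $k\times k$ positive semidefinite matrices. For $1\le i_1<\dots<i_k\le d$ the lift $\varepsilon^d_{i_1\cdots i_k}:\mathbb{S}^k\to\mathbb{S}^d$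 sends $X$ to the matrix with $(i_p,i_q)$ entry $x_{pq}$ and all other entries $0$. For $d\ge k$, $(\mathbb{S}^d_+)_k=\{\sum_{1\le i_1<\dots<i_k\le d}\varepsilon^d_{i_1\cdots i_k}(M_{i_1\cdots i_k}):M_{i_1\cdots i_k}\in\mathbb{S}^k_+\}$. An $(\mathbb{S}^d_+)_k$ cone program is a program in standard form: minimize $\operatorname{tr}(A_0X)$ over $X\in\mathbb{S}^d$ subject to $\operatorname{tr}(A_iX)=b_i$ ($i=1,\dots,p$), $X\in(\mathbb{S}^d_+)_k$; or in inequality form: minimize $q^{\mathsf T}x$ over $x\in\mathbb{R}^{n}$ subject to $x_1P_1+\dots+x_{n}P_{n}+P_0\in(\mathbb{S}^d_+)_k$ with $P_i\in\mathbb{S}^d$. A program $P$ (variable space $V_P$, feasible set $F_P$, objective $c_P$) can be cast into a program $Q$ (with $V_Q,F_Q,c_Q$) if there is an affine map $\pi:V_Q\to V_P$ with $\pi(F_Q)=F_P$ and $c_P(\pi(v))=c_Q(v)$ for all $v\in F_Q$. *)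

theory Defs
  imports "HOL-Library.Poly_Mapping" "Jordan_Normal_Form.VS_Connect"
begin

section \<open>Programs and casting\<close>

record 'v program =
  vspace :: "(real, 'v) module"
  feasible :: "'v set"
  objective :: "'v \<Rightarrow> real"

definition affine_map :: "(real, 'v) module \<Rightarrow> (real, 'w) module \<Rightarrow> ('v \<Rightarrow> 'w) \<Rightarrow> bool" where
  "affine_map V W f \<longleftrightarrow>
     (\<exists>L\<in>LinearCombinations.module_hom class_ring V W. \<exists>c\<in>carrier W. \<forall>v\<in>carrier V. f v = L v \<oplus>\<^bsub>W\<^esub> c)"

definition can_be_cast_into :: "'v program \<Rightarrow> 'w program \<Rightarrow> bool" where
  "can_be_cast_into P Q \<longleftrightarrow>
     (\<exists>f. affine_map (vspace Q) (vspace P) f \<and> f ` feasible Q = feasible P \<and>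
          (\<forall>v\<in>feasible Q. objective P (f v) = objective Q v))"

section \<open>Polynomials and DDSOS programs\<close>

text \<open>A monomial is its exponent vector; the variables are numbered \<open>0, 1, 2, \<dots>\<close>, and a
  polynomial in \<open>n\<close> variables only involves those with number below \<open>n\<close>.\<close>

type_synonym monomial = "nat \<Rightarrow>\<^sub>0 nat"
type_synonym mpolynomial = "monomial \<Rightarrow>\<^sub>0 real"

definition monomials :: "nat \<Rightarrow> nat \<Rightarrow> monomial set" where
  "monomials n d = {m. Poly_Mapping.keys m \<subseteq> {..<n} \<and> (\<Sum>i<n. Poly_Mapping.lookup m i) \<le> d}"

lemma finite_monomials: "finite (monomials n d)"
proof -
  have "finite {f :: nat \<Rightarrow> nat. \<forall>i. (i \<in> {..<n} \<longrightarrow> f i \<in> {..d}) \<and> (i \<notin> {..<n} \<longrightarrow> f i = 0)}"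
    by (rule finite_set_of_finite_funs) auto
  moreover have "Poly_Mapping.lookup ` monomials n d \<subseteq>
      {f. \<forall>i. (i \<in> {..<n} \<longrightarrow> f i \<in> {..d}) \<and> (i \<notin> {..<n} \<longrightarrow> f i = 0)}"
  proof clarify
    fix m i assume m: "m \<in> monomials n d"
    have "Poly_Mapping.lookup m i \<le> d" if "i < n"
      using m that member_le_sum[of i "{..<n}" "Poly_Mapping.lookup m"]
      by (fastforce simp: monomials_def)
    moreover have "Poly_Mapping.lookup m i = 0" if "\<not> i < n"
      using m that by (auto simp: monomials_def subset_iff in_keys_iff)
    ultimately show "(i \<in> {..<n} \<longrightarrow> Poly_Mapping.lookup m i \<in> {..d}) \<and>
        (i \<notin> {..<n} \<longrightarrow> Poly_Mapping.lookup m i = 0)" by auto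
  qed
  ultimately have "finite (Poly_Mapping.lookup ` monomials n d)"
    by (rule rev_finite_subset)
  then show ?thesis
    by (rule finite_imageD) (simp add: inj_on_def poly_mapping_eqI)
qed

definition polynomials :: "nat \<Rightarrow> nat \<Rightarrow> mpolynomial set" where
  "polynomials n D = {p. Poly_Mapping.keys p \<subseteq> monomials n D}"

text \<open>A tuple of indices into an enumeration of the monomials of degree at most \<open>d\<close> is
  represented by the list of the monomials it selects, so that no enumeration has to be fixed.
  The coefficient function \<open>\<alpha> ms j\<close> is indexed by the selected monomial and not by its position
  in the tuple.\<close>

definition kDDSOS :: "nat \<Rightarrow> nat \<Rightarrow> nat \<Rightarrow> mpolynomial \<Rightarrow> bool" where
  "kDDSOS k n d p \<longleftrightarrow>
     (\<exists>(J :: monomial list \<Rightarrow> nat) (\<alpha> :: monomial list \<Rightarrow> nat \<Rightarrow> monomial \<Rightarrow> real).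
        p = (\<Sum>ms | length ms = k \<and> set ms \<subseteq> monomials n d.
               \<Sum>j<J ms. (\<Sum>l<k. Poly_Mapping.single (ms ! l) (\<alpha> ms j (ms ! l)))\<^sup>2))"

definition kSOS :: "nat \<Rightarrow> nat \<Rightarrow> nat \<Rightarrow> mpolynomial set" where
  "kSOS k n d = {p \<in> polynomials n (2 * d). kDDSOS k n d p}"

text \<open>\<open>Poly_Mapping.single 0 c\<close> is the constant polynomial \<open>c\<close>.\<close>

definition DDSOS_program ::
    "nat \<Rightarrow> nat \<Rightarrow> real vec \<Rightarrow> nat \<Rightarrow> (nat \<Rightarrow> nat) \<Rightarrow> (nat \<Rightarrow> nat) \<Rightarrow> (nat \<Rightarrow> nat \<Rightarrow> mpolynomial)
      \<Rightarrow> real vec program" where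
  "DDSOS_program k l r T n d R =
     \<lparr>vspace = module_vec TYPE(real) l,
      feasible = {u \<in> carrier_vec l. \<forall>t\<in>{1..T}.
        R 0 t + (\<Sum>i=1..l. Poly_Mapping.single 0 (u $ (i - 1)) * R i t) \<in> kSOS k (n t) (d t)},
      objective = (\<lambda>u. r \<bullet> u)\<rparr>"

definition DDSOS_programs :: "nat \<Rightarrow> real vec program set" where
  "DDSOS_programs k = {DDSOS_program k l r T n d R | l r T n d R.
     r \<in> carrier_vec l \<and>
     (\<forall>t\<in>{1..T}. 1 \<le> n t \<and> 1 \<le> d t \<and> (\<forall>i\<le>l. R i t \<in> polynomials (n t) (2 * d t)))}"

section \<open>The cone and its programs\<close>

definition sym_mats :: "nat \<Rightarrow> real mat set" where
  "sym_mats d = {X \<in> carrier_mat d d. transpose_mat X = X}"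

definition sym_space :: "nat \<Rightarrow> (real, real mat) module" where
  "sym_space d = (module_mat TYPE(real) d d)\<lparr>carrier := sym_mats d\<rparr>"

definition psd_mats :: "nat \<Rightarrow> real mat set" where
  "psd_mats k = {X \<in> sym_mats k. \<forall>v\<in>carrier_vec k. 0 \<le> v \<bullet> (X *\<^sub>v v)}"

definition mat_trace :: "real mat \<Rightarrow> real" where
  "mat_trace X = (\<Sum>i<dim_row X. X $$ (i, i))"

text \<open>Rows and columns are numbered from \<open>0\<close>.\<close>

definition index_tuples :: "nat \<Rightarrow> nat \<Rightarrow> nat list set" where
  "index_tuples k d = {ix. length ix = k \<and> sorted_wrt (<) ix \<and> set ix \<subseteq> {..<d}}"

text \<open>As the entries of \<open>ix\<close> are distinct, at most one summand below is nonzero.\<close>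

definition lift_mat :: "nat \<Rightarrow> nat list \<Rightarrow> real mat \<Rightarrow> real mat" where
  "lift_mat d ix X = mat d d (\<lambda>(a, b).
     \<Sum>p<length ix. \<Sum>q<length ix. if ix ! p = a \<and> ix ! q = b then X $$ (p, q) else 0)"

definition psd_cone :: "nat \<Rightarrow> nat \<Rightarrow> real mat set" where
  "psd_cone k d = {(\<Oplus>\<^bsub>module_mat TYPE(real) d d\<^esub>ix\<in>index_tuples k d. lift_mat d ix (M ix)) | M.
     \<forall>ix\<in>index_tuples k d. M ix \<in> psd_mats k}"

definition standard_cone_program ::
    "nat \<Rightarrow> nat \<Rightarrow> nat \<Rightarrow> (nat \<Rightarrow> real mat) \<Rightarrow> (nat \<Rightarrow> real) \<Rightarrow> real mat program" where
  "standard_cone_program k d p A b =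
     \<lparr>vspace = sym_space d,
      feasible = {X \<in> sym_mats d. (\<forall>i\<in>{1..p}. mat_trace (A i * X) = b i) \<and> X \<in> psd_cone k d},
      objective = (\<lambda>X. mat_trace (A 0 * X))\<rparr>"

text \<open>The data matrices are taken symmetric without loss of generality, as only their
  symmetric parts enter the traces.\<close>

definition standard_cone_programs :: "nat \<Rightarrow> nat \<Rightarrow> real mat program set" where
  "standard_cone_programs k d =
     {standard_cone_program k d p A b | p A b. \<forall>i\<le>p. A i \<in> sym_mats d}"

definition inequality_cone_program ::
    "nat \<Rightarrow> nat \<Rightarrow> nat \<Rightarrow> real vec \<Rightarrow> (nat \<Rightarrow> real mat) \<Rightarrow> real vec program" where
  "inequality_cone_program k d n q P =
     \<lparr>vspace = module_vec TYPE(real) n,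
      feasible = {x \<in> carrier_vec n.
        (\<Oplus>\<^bsub>module_mat TYPE(real) d d\<^esub>i\<in>{1..n}. (x $ (i - 1)) \<cdot>\<^sub>m P i) + P 0 \<in> psd_cone k d},
      objective = (\<lambda>x. q \<bullet> x)\<rparr>"

definition inequality_cone_programs :: "nat \<Rightarrow> nat \<Rightarrow> real vec program set" where
  "inequality_cone_programs k d =
     {inequality_cone_program k d n q P | n q P.
        q \<in> carrier_vec n \<and> (\<forall>i\<le>n. P i \<in> sym_mats d)}"

end

theory Submission
  imports Defs
begin

text \<open>Both kinds of cone are images of one object: the cone of all finite sums of rank-one matrices
  \<open>c c\<^sup>T\<close> in which every vector \<open>c\<close> has at most \<open>k\<close> nonzero entries (\<open>sparse_cone\<close>, for matrices
  indexed by an arbitrary set). A positive semidefinite \<open>k \<times> k\<close> matrix is a sum of rank-one matrices,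
  so summing lifts of such matrices gives exactly the sparse sums (\<open>psd_cone_eq_sparse_cone\<close>). On the
  polynomial side, the square of a combination of at most \<open>k\<close> monomials has a sparse rank-one Gram
  matrix, so the polynomials in \<open>kSOS k n d\<close> are those that have some Gram matrix, indexed by the
  monomials of degree at most \<open>d\<close>, in the sparse cone (\<open>kSOS_eq_gram\<close>). The Gram matrix of a
  polynomial is not unique, and this accounts for the two different constructions.

  From cone programs to DDSOS programs. A quadratic form has only one symmetric Gram matrix
  in the degree one part of the basis. Hence a quadratic form \<open>x\<^sup>T H x\<close> plus a linear form \<open>v\<^sup>T x\<close>
  lies in \<open>kSOS k n 1\<close> iff \<open>H\<close> is in the sparse cone and \<open>v = 0\<close>: as the constant term is zero, every
  square has zero constant part, and nothing can produce linear terms (\<open>quadratic_in_kSOS_iff\<close>). So one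
  polynomial whose coefficients are affine in the decision vector expresses membership of \<open>H\<close> in the cone
  through its quadratic part and all equality constraints through its linear part. An inequality form
  program is recovered with the identity map; for a standard form program the symmetric matrix is
  parametrised by the \<open>d\<^sup>2\<close> entries of an arbitrary matrix, symmetrised.

  From DDSOS programs to cone programs. The Gram matrices of all the constraints are put on the diagonal
  of one large symmetric matrix variable \<open>X\<close>, and equality of polynomials becomes finitely many linear
  equations in the entries of \<open>X\<close>, one for each coefficient. Free decision variables are written as
  differences of two further diagonal entries, which may be arbitrary nonnegative numbers.
  The entries outside the diagonal blocks stay free, because principal submatrices of
  elements of the sparse cone are again in the sparse cone (\<open>sparse_cone_pullback\<close>). The map taking
  \<open>X\<close> to these differences is linear and maps the feasible set onto the feasible set of the DDSOS
  program (\<open>cast_DDSOS_program\<close>).\<close>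
section \<open>Sums of sparse rank-one matrices\<close>

text \<open>Matrices are functions here rather than elements of a matrix type, since the index sets in use
  are sets of monomials and sums of such sets. The matrices vanish outside of \<open>S\<close>.\<close>
inductive_set sparse_cone :: "nat \<Rightarrow> 'a set \<Rightarrow> ('a \<Rightarrow> 'a \<Rightarrow> real) set"
  for k :: nat and S :: "'a set" where
  zero: "(\<lambda>_ _. 0) \<in> sparse_cone k S"
| add_square: "\<lbrakk>G \<in> sparse_cone k S; A \<subseteq> S; finite A; card A \<le> k; \<And>a. a \<notin> A \<Longrightarrow> c a = 0\<rbrakk>
    \<Longrightarrow> (\<lambda>a b. G a b + c a * c b) \<in> sparse_cone k S"

lemma sparse_cone_add:
  assumes "G \<in> sparse_cone k S" "H \<in> sparse_cone k S"
  shows "(\<lambda>a b. G a b + H a b) \<in> sparse_cone k S"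
  using assms(2)
proof induction
  case zero
  then show ?case using assms(1) by simp
next
  case (add_square H A c)
  then show ?case
    using sparse_cone.add_square[OF add_square.IH add_square.hyps(2-5)] by (simp add: add.assoc)
qed

lemma sparse_cone_sum:
  assumes "\<And>i. i \<in> I \<Longrightarrow> G i \<in> sparse_cone k S"
  shows "(\<lambda>a b. \<Sum>i\<in>I. G i a b) \<in> sparse_cone k S"
  using assms
proof (induction I rule: infinite_finite_induct)
  case (insert i I)
  then show ?case
    using sparse_cone_add[of "G i" k S "\<lambda>a b. \<Sum>i\<in>I. G i a b"] by simp
qed (simp_all add: sparse_cone.zero)

lemma sparse_cone_square:
  assumes "A \<subseteq> S" "finite A" "card A \<le> k" "\<And>a. a \<notin> A \<Longrightarrow> c a = 0"
  shows "(\<lambda>a b. c a * c b) \<in> sparse_cone k S"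
  using sparse_cone.add_square[OF sparse_cone.zero assms] by simp

lemma sparse_cone_mono: "G \<in> sparse_cone k S \<Longrightarrow> S \<subseteq> S' \<Longrightarrow> G \<in> sparse_cone k S'"
  by (induction rule: sparse_cone.induct) (auto intro: sparse_cone.intros)

lemma sparse_cone_support: "G \<in> sparse_cone k S \<Longrightarrow> a \<notin> S \<or> b \<notin> S \<Longrightarrow> G a b = 0"
  by (induction rule: sparse_cone.induct) (auto simp: subset_iff)

lemma sparse_cone_sym: "G \<in> sparse_cone k S \<Longrightarrow> G a b = G b a"
  by (induction rule: sparse_cone.induct) auto

text \<open>A sum of squares can only vanish if all the squares do: a zero on the diagonal forces a zero row.
  This is what excludes linear terms from a sum of squares without constant term.\<close>
lemma sparse_cone_diagonal:
  "G \<in> sparse_cone k S \<Longrightarrow> 0 \<le> G a a \<and> (G a a = 0 \<longrightarrow> G a b = 0)"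
  by (induction rule: sparse_cone.induct) (auto simp: add_nonneg_eq_0_iff)

text \<open>Relabelling along an injection, restriction to a principal submatrix and extension by zeros are all
  instances of this pullback. Injectivity keeps the number of nonzero entries of each vector at most \<open>k\<close>.\<close>
lemma sparse_cone_pullback:
  assumes "G \<in> sparse_cone k A" and F: "inj_on F B" "F ` B \<subseteq> A"
  shows "(\<lambda>x y. if x \<in> B \<and> y \<in> B then G (F x) (F y) else 0) \<in> sparse_cone k B"
  using assms(1)
proof induction
  case zero
  then show ?case by (simp add: sparse_cone.zero cong: if_cong)
next
  case (add_square G C c)
  define D where "D = {x \<in> B. F x \<in> C}"
  have D: "inj_on F D" "F ` D \<subseteq> C"
    using F by (auto simp: D_def inj_on_def)
  have "(\<lambda>x y. (if x \<in> B \<and> y \<in> B then G (F x) (F y) else 0)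
      + (if x \<in> B then c (F x) else 0) * (if y \<in> B then c (F y) else 0)) \<in> sparse_cone k B"
  proof (rule sparse_cone.add_square[where A = D])
    show "finite D" using inj_on_finite[OF D] add_square.hyps by blast
    show "card D \<le> k" using card_inj_on_le[OF D] add_square.hyps by fastforce
  qed (use add_square in \<open>auto simp: D_def\<close>)
  then show ?case
    by (rule back_subst[where P = "\<lambda>H. H \<in> _"]) (auto intro!: ext)
qed

definition quad_form :: "'a set \<Rightarrow> ('a \<Rightarrow> 'a \<Rightarrow> real) \<Rightarrow> ('a \<Rightarrow> real) \<Rightarrow> real" where
  "quad_form S G x = (\<Sum>a\<in>S. \<Sum>b\<in>S. x a * G a b * x b)"

lemma quad_form_insert:
  assumes "finite S" "s \<notin> S" and sym: "\<And>a b. G a b = G b a"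
  shows "quad_form (insert s S) G x
    = quad_form S G x + 2 * x s * (\<Sum>b\<in>S. G s b * x b) + (x s)\<^sup>2 * G s s"
proof -
  have "(\<Sum>a\<in>S. x a * G a s * x s) = x s * (\<Sum>b\<in>S. G s b * x b)"
    by (simp add: sum_distrib_left sym[of _ s] mult_ac)
  moreover have "(\<Sum>b\<in>S. x s * G s b * x b) = x s * (\<Sum>b\<in>S. G s b * x b)"
    by (simp add: sum_distrib_left mult_ac)
  ultimately show ?thesis
    using assms(1,2) by (simp add: quad_form_def sum.distrib power2_eq_square)
qed

text \<open>Lagrange's reduction of a quadratic form, one index at a time. If the diagonal entry at the index
  \<open>s\<close> vanishes, so does its row; otherwise subtracting the square of the row, scaled by that entry, clears
  it and leaves a form that is still nonnegative.\<close>
lemma psd_in_sparse_cone: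
  assumes "finite S" "card S \<le> k" "\<And>a b. G a b = G b a" "\<And>a b. a \<notin> S \<Longrightarrow> G a b = 0"
    and "\<And>x. 0 \<le> quad_form S G x"
  shows "G \<in> sparse_cone k S"
  using assms
proof (induction S arbitrary: G rule: finite_induct)
  case empty
  then have "G = (\<lambda>_ _. 0)" by (auto intro!: ext)
  then show ?case by (simp add: sparse_cone.zero)
next
  case (insert s S)
  note sym = insert.prems(2) and supp = insert.prems(3)
  have card: "card S \<le> k" using insert.prems(1) insert.hyps by simp
  have nonneg: "0 \<le> quad_form S G x + 2 * t * (\<Sum>b\<in>S. G s b * x b) + t\<^sup>2 * G s s" for x t
  proof -
    have "quad_form S G (x(s := t)) = quad_form S G x"
      "(\<Sum>b\<in>S. G s b * (x(s := t)) b) = (\<Sum>b\<in>S. G s b * x b)"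
      using insert.hyps by (auto simp: quad_form_def intro!: sum.cong)
    then show ?thesis
      using insert.prems(4)[of "x(s := t)"] by (simp add: quad_form_insert[OF insert.hyps sym] del: fun_upd_apply) simp
  qed
  have "0 \<le> G s s" using nonneg[of "\<lambda>_. 0" 1] by (simp add: quad_form_def)
  then consider "G s s = 0" | "G s s > 0" by linarith
  then show ?case
  proof cases
    case 1
    have row: "G s b = 0" if "b \<in> S" for b
    proof (rule ccontr)
      assume nz: "G s b \<noteq> 0"
      let ?e = "\<lambda>a. if a = b then 1 else (0::real)"
      have "(\<Sum>c\<in>S. G s c * ?e c) = G s b"
        using that insert.hyps by (simp add: if_distrib cong: if_cong)
      \<comment> \<open>with a zero diagonal entry the form is affine in the coordinate at \<open>s\<close>; this value makes it \<open>-1\<close>\<close>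
      then show False
        using nonneg[of ?e "- (quad_form S G ?e + 1) / (2 * G s b)"] nz 1 by (simp add: field_simps)
    qed
    have "G s b = 0" for b
      using row 1 supp[of b s] sym[of s b] by (cases "b \<in> insert s S") auto
    then have "G a b = 0" if "a \<notin> S" for a b
      using that supp[of a b] by (cases "a = s") auto
    moreover have "0 \<le> quad_form S G x" for x
      using nonneg[of x 0] by simp
    ultimately have "G \<in> sparse_cone k S"
      by (intro insert.IH card sym)
    then show ?thesis by (rule sparse_cone_mono) auto
  next
    case 2
    define H where "H a b = G a b - G s a * G s b / G s s" for a b
    have "H \<in> sparse_cone k S"
    proof (rule insert.IH[OF card])
      show "H a b = H b a" for a b by (simp add: H_def sym[of a b])
      show "H a b = 0" if "a \<notin> S" for a b
        using that 2 supp[of a] sym[of s a] by (cases "a = s") (auto simp: H_def)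
      show "0 \<le> quad_form S H x" for x
      proof -
        define w where "w = (\<Sum>b\<in>S. G s b * x b)"
        have w2: "w * w = (\<Sum>a\<in>S. \<Sum>b\<in>S. x a * (G s a * G s b) * x b)"
          unfolding w_def sum_product by (simp add: mult_ac)
        have "quad_form S H x = quad_form S G x - w * w / G s s"
          unfolding w2 quad_form_def H_def sum_divide_distrib sum_subtractf[symmetric]
          by (intro sum.cong refl) (simp add: algebra_simps)
        \<comment> \<open>\<open>- w / G s s\<close> minimises the form over the coordinate at \<open>s\<close>\<close>
        also have "\<dots> = quad_form S G x + 2 * (- w / G s s) * w + (- w / G s s)\<^sup>2 * G s s"
          using 2 by (simp add: field_simps power2_eq_square)
        finally show ?thesis using nonneg[of x "- w / G s s"] by (simp add: w_def)
      qed
    qed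
    then have "H \<in> sparse_cone k (insert s S)" by (rule sparse_cone_mono) auto
    then have "(\<lambda>a b. H a b + G s a / sqrt (G s s) * (G s b / sqrt (G s s)))
        \<in> sparse_cone k (insert s S)"
      by (rule sparse_cone.add_square[where A = "insert s S"])
        (use insert.hyps insert.prems(1) supp sym in auto)
    then show ?thesis
      by (rule back_subst[where P = "\<lambda>H. H \<in> _"]) (use 2 in \<open>auto intro!: ext simp: H_def\<close>)
  qed
qed

section \<open>The cone of matrices\<close>

lemma index_finsum_mat:
  assumes "finite I" "\<And>i. i \<in> I \<Longrightarrow> f i \<in> carrier_mat nr nc"
  shows "(\<Oplus>\<^bsub>module_mat TYPE(real) nr nc\<^esub>i\<in>I. f i) \<in> carrier_mat nr nc"
    and "a < nr \<Longrightarrow> b < nc \<Longrightarrow>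
      (\<Oplus>\<^bsub>module_mat TYPE(real) nr nc\<^esub>i\<in>I. f i) $$ (a, b) = (\<Sum>i\<in>I. f i $$ (a, b))"
proof -
  interpret abelian_group "module_mat TYPE(real) nr nc" by (rule abelian_group_mat)
  have "(\<Oplus>\<^bsub>module_mat TYPE(real) nr nc\<^esub>i\<in>I. f i) \<in> carrier_mat nr nc \<and>
    (a < nr \<longrightarrow> b < nc \<longrightarrow>
      (\<Oplus>\<^bsub>module_mat TYPE(real) nr nc\<^esub>i\<in>I. f i) $$ (a, b) = (\<Sum>i\<in>I. f i $$ (a, b)))" for a b
    using assms
  proof induction
    case empty
    then show ?case by (simp add: module_mat_simps)
  next
    case (insert i I)
    have "(\<Oplus>\<^bsub>module_mat TYPE(real) nr nc\<^esub>i\<in>insert i I. f i)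
        = f i + (\<Oplus>\<^bsub>module_mat TYPE(real) nr nc\<^esub>i\<in>I. f i)"
      using insert.hyps insert.prems
      by (subst finsum_insert) (auto simp: module_mat_simps)
    then show ?case using insert by (auto simp del: finsum_insert)
  qed
  then show "(\<Oplus>\<^bsub>module_mat TYPE(real) nr nc\<^esub>i\<in>I. f i) \<in> carrier_mat nr nc"
    and "a < nr \<Longrightarrow> b < nc \<Longrightarrow>
      (\<Oplus>\<^bsub>module_mat TYPE(real) nr nc\<^esub>i\<in>I. f i) $$ (a, b) = (\<Sum>i\<in>I. f i $$ (a, b))"
    by auto
qed

lemma finite_index_tuples: "finite (index_tuples k d)"
  by (rule finite_subset[OF _ finite_lists_length_eq[of "{..<d}" k]]) (auto simp: index_tuples_def)

lemma index_psd_sum: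
  assumes "a < d" "b < d"
  shows "(\<Oplus>\<^bsub>module_mat TYPE(real) d d\<^esub>ix\<in>index_tuples k d. lift_mat d ix (M ix)) $$ (a, b)
    = (\<Sum>ix\<in>index_tuples k d. lift_mat d ix (M ix) $$ (a, b))"
  using assms by (intro index_finsum_mat finite_index_tuples) (auto simp: lift_mat_def)

lemma psd_cone_carrier: "X \<in> psd_cone k d \<Longrightarrow> X \<in> carrier_mat d d"
  unfolding psd_cone_def
  by (auto simp: lift_mat_def finite_index_tuples intro!: index_finsum_mat)

lemma quadratic_form_mat:
  assumes "X \<in> carrier_mat k k" "v \<in> carrier_vec k"
  shows "v \<bullet> (X *\<^sub>v v) = quad_form {..<k} (\<lambda>a b. X $$ (a, b)) (\<lambda>a. v $ a)"
  using assms
  by (auto simp: quad_form_def scalar_prod_def sum_distrib_left lessThan_atLeast0 mult_ac intro!: sum.cong)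

lemma psd_mats_iff:
  "X \<in> psd_mats k \<longleftrightarrow> X \<in> sym_mats k \<and> (\<forall>x. 0 \<le> quad_form {..<k} (\<lambda>a b. X $$ (a, b)) x)"
proof -
  have "(\<forall>v\<in>carrier_vec k. 0 \<le> v \<bullet> (X *\<^sub>v v)) \<longleftrightarrow> (\<forall>x. 0 \<le> quad_form {..<k} (\<lambda>a b. X $$ (a, b)) x)"
    if X: "X \<in> carrier_mat k k"
  proof safe
    fix x assume "\<forall>v\<in>carrier_vec k. 0 \<le> v \<bullet> (X *\<^sub>v v)"
    then have "0 \<le> quad_form {..<k} (\<lambda>a b. X $$ (a, b)) (\<lambda>a. vec k x $ a)"
      using quadratic_form_mat[OF X, of "vec k x"] by (metis vec_carrier)
    then show "0 \<le> quad_form {..<k} (\<lambda>a b. X $$ (a, b)) x" by (simp add: quad_form_def)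
  qed (simp add: quadratic_form_mat[OF X])
  then show ?thesis by (auto simp: psd_mats_def sym_mats_def)
qed

lemma sym_mats_index: "X \<in> sym_mats d \<Longrightarrow> a < d \<Longrightarrow> b < d \<Longrightarrow> X $$ (a, b) = X $$ (b, a)"
  unfolding sym_mats_def by (metis (mono_tags, lifting) carrier_matD index_transpose_mat(1) mem_Collect_eq)

lemma sym_matsI: "X \<in> carrier_mat d d \<Longrightarrow> (\<And>a b. a < d \<Longrightarrow> b < d \<Longrightarrow> X $$ (a, b) = X $$ (b, a))
    \<Longrightarrow> X \<in> sym_mats d"
  unfolding sym_mats_def by auto

lemma psd_mats_zero: "0\<^sub>m k k \<in> psd_mats k"
  unfolding psd_mats_iff by (auto simp: quad_form_def intro!: sym_matsI)

lemma psd_mats_add_square: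
  assumes "X \<in> psd_mats k"
  shows "X + mat k k (\<lambda>(a, b). c a * c b) \<in> psd_mats k"
proof -
  have X: "X \<in> sym_mats k" "X \<in> carrier_mat k k" using assms by (auto simp: psd_mats_def sym_mats_def)
  have "quad_form {..<k} (\<lambda>a b. (X + mat k k (\<lambda>(a, b). c a * c b)) $$ (a, b)) x
      = quad_form {..<k} (\<lambda>a b. X $$ (a, b)) x + (\<Sum>a<k. c a * x a)\<^sup>2" for x
    using X(2) unfolding quad_form_def power2_eq_square sum_product sum.distrib[symmetric]
    by (intro sum.cong refl) (auto simp: algebra_simps)
  then show ?thesis
    using assms X by (auto simp: psd_mats_iff sym_mats_index intro!: sym_matsI)
qed

lemma sum_sum_delta:
  fixes f :: "nat \<Rightarrow> nat \<Rightarrow> real"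
  assumes "p < k" "q < k"
  shows "(\<Sum>p'<k. \<Sum>q'<k. if p' = p \<and> q' = q then f p' q' else 0) = f p q"
proof -
  have "(\<Sum>p'<k. \<Sum>q'<k. if p' = p \<and> q' = q then f p' q' else 0)
      = (\<Sum>p'<k. if p' = p then (\<Sum>q'<k. if q' = q then f p' q' else 0) else 0)"
    by (intro sum.cong refl) auto
  also have "\<dots> = f p q" using assms by simp
  finally show ?thesis .
qed

lemma lift_mat_index:
  assumes "ix \<in> index_tuples k d" "a < d" "b < d"
  shows "p < k \<Longrightarrow> q < k \<Longrightarrow> lift_mat d ix X $$ (ix ! p, ix ! q) = X $$ (p, q)"
    and "a \<notin> set ix \<or> b \<notin> set ix \<Longrightarrow> lift_mat d ix X $$ (a, b) = 0"
proof -
  have ix: "length ix = k" "distinct ix" "set ix \<subseteq> {..<d}"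
    using assms by (auto simp: index_tuples_def strict_sorted_iff)
  show "lift_mat d ix X $$ (a, b) = 0" if "a \<notin> set ix \<or> b \<notin> set ix"
    using that assms(2,3) by (auto simp: lift_mat_def intro!: sum.neutral)
  assume pq: "p < k" "q < k"
  then have "ix ! p < d" "ix ! q < d" using ix by (auto simp: subset_iff)
  then have "lift_mat d ix X $$ (ix ! p, ix ! q)
      = (\<Sum>p'<k. \<Sum>q'<k. if p' = p \<and> q' = q then X $$ (p', q') else 0)"
    using pq ix by (auto simp: lift_mat_def nth_eq_iff_index_eq intro!: sum.cong)
  also have "\<dots> = X $$ (p, q)" by (rule sum_sum_delta[OF pq])
  finally show "lift_mat d ix X $$ (ix ! p, ix ! q) = X $$ (p, q)" .
qed

text \<open>The lift is the pullback of \<open>X\<close> along the inverse of the enumeration \<open>ix\<close> of its index set.\<close>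
lemma lift_mat_in_sparse_cone:
  assumes ix: "ix \<in> index_tuples k d" and X: "X \<in> psd_mats k"
  shows "(\<lambda>a b. if a < d \<and> b < d then lift_mat d ix X $$ (a, b) else 0) \<in> sparse_cone k {..<d}"
proof -
  have ix': "length ix = k" "distinct ix" "set ix \<subseteq> {..<d}"
    using assms by (auto simp: index_tuples_def strict_sorted_iff)
  have sym: "X \<in> sym_mats k" using X by (simp add: psd_mats_def)
  define G where "G a b = (if a < k \<and> b < k then X $$ (a, b) else 0)" for a b
  have "quad_form {..<k} G x = quad_form {..<k} (\<lambda>a b. X $$ (a, b)) x" for x
    by (auto simp: quad_form_def G_def intro!: sum.cong)
  then have "G \<in> sparse_cone k {..<k}"
    using X sym_mats_index[OF sym] by (intro psd_in_sparse_cone) (auto simp: G_def psd_mats_iff)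
  moreover define F where "F = the_inv_into {..<k} ((!) ix)"
  have bij: "bij_betw ((!) ix) {..<k} (set ix)" using bij_betw_nth[OF ix'(2)] ix'(1) by auto
  have bijF: "bij_betw F (set ix) {..<k}" unfolding F_def by (rule bij_betw_the_inv_into[OF bij])
  ultimately have "(\<lambda>x y. if x \<in> set ix \<and> y \<in> set ix then G (F x) (F y) else 0) \<in> sparse_cone k (set ix)"
    by (intro sparse_cone_pullback[where A = "{..<k}"]) (auto simp: bij_betw_def)
  then have "(\<lambda>x y. if x \<in> set ix \<and> y \<in> set ix then G (F x) (F y) else 0) \<in> sparse_cone k {..<d}"
    using ix'(3) by (rule sparse_cone_mono)
  then show ?thesis
  proof (rule back_subst[where P = "\<lambda>H. H \<in> _"], intro ext)
    fix a b
    show "(if a \<in> set ix \<and> b \<in> set ix then G (F a) (F b) else 0)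
      = (if a < d \<and> b < d then lift_mat d ix X $$ (a, b) else 0)"
    proof (cases "a \<in> set ix \<and> b \<in> set ix")
      case True
      have F: "F a < k" "F b < k" "ix ! F a = a" "ix ! F b = b"
        using True bijF f_the_inv_into_f_bij_betw[OF bij] by (auto simp: F_def bij_betw_def)
      moreover have "a < d" "b < d" using True ix'(3) by auto
      ultimately show ?thesis
        using True lift_mat_index(1)[OF ix \<open>a < d\<close> \<open>b < d\<close> F(1,2), of X] by (simp add: G_def)
    next
      case False
      then show ?thesis using lift_mat_index(2)[OF ix, of a b X] by auto
    qed
  qed
qed

text \<open>A vector with fewer than \<open>k\<close> nonzero entries is treated as one supported on some set \<open>B\<close> of exactly
  \<open>k\<close> indices, which exists because \<open>k \<le> d\<close>; its square is absorbed by the summand that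
  belongs to \<open>B\<close>.\<close>
lemma psd_cone_add_square:
  assumes X: "mat d d (\<lambda>(a, b). G a b) \<in> psd_cone k d" and "k \<le> d"
    and A: "A \<subseteq> {..<d}" "card A \<le> k" "\<And>a. a \<notin> A \<Longrightarrow> c a = 0"
  shows "mat d d (\<lambda>(a, b). G a b + c a * c b) \<in> psd_cone k d"
proof -
  obtain M where M: "mat d d (\<lambda>(a, b). G a b)
      = (\<Oplus>\<^bsub>module_mat TYPE(real) d d\<^esub>ix\<in>index_tuples k d. lift_mat d ix (M ix))"
    "\<And>ix. ix \<in> index_tuples k d \<Longrightarrow> M ix \<in> psd_mats k"
    using X by (auto simp: psd_cone_def)
  obtain B where B: "A \<subseteq> B" "B \<subseteq> {..<d}" "card B = k"
    using exists_subset_between[of A k "{..<d}"] A assms(2) by auto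
  then have "finite B" using finite_subset by blast
  define iy where "iy = sorted_list_of_set B"
  have iy: "iy \<in> index_tuples k d" "set iy = B"
    using B \<open>finite B\<close> by (auto simp: iy_def index_tuples_def)
  define Y where "Y = mat k k (\<lambda>(p, q). c (iy ! p) * c (iy ! q))"
  define M' where "M' = M(iy := M iy + Y)"
  have carr: "M ix \<in> carrier_mat k k" if "ix \<in> index_tuples k d" for ix
    using M(2)[OF that] by (simp add: psd_mats_def sym_mats_def)
  have liftY: "lift_mat d iy (M iy + Y) $$ (a, b) = lift_mat d iy (M iy) $$ (a, b) + c a * c b"
    if ab: "a < d" "b < d" for a b
  proof (cases "a \<in> set iy \<and> b \<in> set iy")
    case True
    then obtain p q where pq: "a = iy ! p" "b = iy ! q" "p < k" "q < k"
      using iy(1) by (auto simp: in_set_conv_nth index_tuples_def)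
    show ?thesis
      unfolding pq lift_mat_index(1)[OF iy(1) ab pq(3,4)] using pq carr[OF iy(1)] by (simp add: Y_def)
  next
    case False
    then have "c a * c b = 0" using iy(2) B(1) A(3) by auto
    then show ?thesis using False lift_mat_index(2)[OF iy(1) ab] by auto
  qed
  let ?S = "\<Oplus>\<^bsub>module_mat TYPE(real) d d\<^esub>ix\<in>index_tuples k d. lift_mat d ix (M' ix)"
  have "mat d d (\<lambda>(a, b). G a b + c a * c b) = ?S"
  proof (rule eq_matI)
    have carr: "?S \<in> carrier_mat d d" by (intro index_finsum_mat finite_index_tuples) (simp add: lift_mat_def)
    then show "dim_row (mat d d (\<lambda>(a, b). G a b + c a * c b)) = dim_row ?S"
      "dim_col (mat d d (\<lambda>(a, b). G a b + c a * c b)) = dim_col ?S" by auto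
    fix a b assume "a < dim_row ?S" "b < dim_col ?S"
    then have ab: "a < d" "b < d" using carr by auto
    have "?S $$ (a, b) = (\<Sum>ix\<in>index_tuples k d. lift_mat d ix (M ix) $$ (a, b)
        + (if ix = iy then c a * c b else 0))"
      unfolding index_psd_sum[OF ab] by (intro sum.cong refl) (simp add: M'_def liftY[OF ab])
    also have "\<dots> = mat d d (\<lambda>(a, b). G a b) $$ (a, b) + c a * c b"
      unfolding M(1) index_psd_sum[OF ab] using iy(1) finite_index_tuples
      by (simp add: sum.distrib)
    finally show "mat d d (\<lambda>(a, b). G a b + c a * c b) $$ (a, b) = ?S $$ (a, b)"
      using ab by simp
  qed
  moreover have "\<forall>ix\<in>index_tuples k d. M' ix \<in> psd_mats k"
    using M(2) iy(1) psd_mats_add_square unfolding M'_def Y_def by auto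
  ultimately show ?thesis unfolding psd_cone_def by blast
qed

lemma psd_cone_eq_sparse_cone:
  assumes "k \<le> d"
  shows "psd_cone k d = (\<lambda>G. mat d d (\<lambda>(a, b). G a b)) ` sparse_cone k {..<d}"
proof safe
  fix X assume X: "X \<in> psd_cone k d"
  then obtain M where M: "X = (\<Oplus>\<^bsub>module_mat TYPE(real) d d\<^esub>ix\<in>index_tuples k d. lift_mat d ix (M ix))"
    "\<And>ix. ix \<in> index_tuples k d \<Longrightarrow> M ix \<in> psd_mats k"
    by (auto simp: psd_cone_def)
  let ?G = "\<lambda>a b. \<Sum>ix\<in>index_tuples k d. if a < d \<and> b < d then lift_mat d ix (M ix) $$ (a, b) else 0"
  have "?G \<in> sparse_cone k {..<d}"
    by (intro sparse_cone_sum lift_mat_in_sparse_cone M(2))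
  moreover have "X = mat d d (\<lambda>(a, b). ?G a b)"
    using psd_cone_carrier[OF X] by (intro eq_matI) (auto simp: M(1) index_psd_sum)
  ultimately show "X \<in> (\<lambda>G. mat d d (\<lambda>(a, b). G a b)) ` sparse_cone k {..<d}" by blast
next
  fix G :: "nat \<Rightarrow> nat \<Rightarrow> real"
  assume "G \<in> sparse_cone k {..<d}"
  then show "mat d d (\<lambda>(a, b). G a b) \<in> psd_cone k d"
  proof induction
    case zero
    let ?S = "\<Oplus>\<^bsub>module_mat TYPE(real) d d\<^esub>ix\<in>index_tuples k d. lift_mat d ix (0\<^sub>m k k)"
    have "lift_mat d ix (0\<^sub>m k k) $$ (a, b) = 0" if "ix \<in> index_tuples k d" "a < d" "b < d" for ix a b
      using that by (auto simp: lift_mat_def index_tuples_def intro!: sum.neutral)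
    moreover have "?S \<in> carrier_mat d d"
      by (intro index_finsum_mat finite_index_tuples) (simp add: lift_mat_def)
    ultimately have "mat d d (\<lambda>_. 0) = ?S"
      by (intro eq_matI) (auto simp: index_psd_sum)
    then have "mat d d (\<lambda>_. 0) \<in> psd_cone k d"
      unfolding psd_cone_def using psd_mats_zero
      by (intro CollectI exI[of _ "\<lambda>_. 0\<^sub>m k k"]) auto
    then show ?case by (simp add: case_prod_unfold)
  next
    case (add_square G A c)
    then show ?case using psd_cone_add_square[OF _ assms] by blast
  qed
qed

section \<open>Gram matrices of polynomials\<close>

lemma monomials_add:
  assumes "a \<in> monomials n d" "b \<in> monomials n e"
  shows "a + b \<in> monomials n (d + e)"
  using assms Poly_Mapping.keys_add[of a b]
  by (auto simp: monomials_def lookup_add sum.distrib)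

lemma polynomials_single: "m \<in> monomials n D \<Longrightarrow> Poly_Mapping.single m c \<in> polynomials n D"
  by (auto simp: polynomials_def)

lemma polynomials_add: "p \<in> polynomials n D \<Longrightarrow> q \<in> polynomials n D \<Longrightarrow> p + q \<in> polynomials n D"
  using Poly_Mapping.keys_add[of p q] by (auto simp: polynomials_def)

lemma polynomials_zero: "0 \<in> polynomials n D"
  by (simp add: polynomials_def)

lemma polynomials_sum: "(\<And>i. i \<in> I \<Longrightarrow> p i \<in> polynomials n D) \<Longrightarrow> sum p I \<in> polynomials n D"
  by (induction I rule: infinite_finite_induct) (auto intro: polynomials_add polynomials_zero)

lemma lookup_outside_polynomials:
  "p \<in> polynomials n D \<Longrightarrow> m \<notin> monomials n D \<Longrightarrow> Poly_Mapping.lookup p m = 0"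
  by (auto simp: polynomials_def in_keys_iff subset_iff)

lemma single_sum: "Poly_Mapping.single m (\<Sum>i\<in>I. f i) = (\<Sum>i\<in>I. Poly_Mapping.single m (f i))"
  by (induction I rule: infinite_finite_induct) (auto simp: single_add)

lemma lookup_const_mult:
  "Poly_Mapping.lookup (Poly_Mapping.single 0 c * p) m = c * Poly_Mapping.lookup p m"
  for p :: mpolynomial
  by (simp add: Poly_Mapping.mult_map_scale_conv_mult[symmetric] Poly_Mapping.map.rep_eq when_def)

lemma polynomials_const_mult:
  "p \<in> polynomials n D \<Longrightarrow> Poly_Mapping.single 0 c * p \<in> polynomials n D"
  by (auto simp: polynomials_def in_keys_iff lookup_const_mult subset_iff)

definition gram_poly :: "monomial set \<Rightarrow> (monomial \<Rightarrow> monomial \<Rightarrow> real) \<Rightarrow> mpolynomial" where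
  "gram_poly S G = (\<Sum>a\<in>S. \<Sum>b\<in>S. Poly_Mapping.single (a + b) (G a b))"

lemma lookup_gram_poly:
  "Poly_Mapping.lookup (gram_poly S G) m = (\<Sum>a\<in>S. \<Sum>b\<in>S. if a + b = m then G a b else 0)"
  by (simp add: gram_poly_def lookup_sum lookup_single when_def)

lemma gram_poly_cong:
  "(\<And>a b. a \<in> S \<Longrightarrow> b \<in> S \<Longrightarrow> G a b = H a b) \<Longrightarrow> gram_poly S G = gram_poly S H"
  by (simp add: gram_poly_def)

lemma gram_poly_add: "gram_poly S (\<lambda>a b. G a b + H a b) = gram_poly S G + gram_poly S H"
  by (simp add: gram_poly_def single_add sum.distrib)

lemma gram_poly_sum: "gram_poly S (\<lambda>a b. \<Sum>i\<in>I. G i a b) = (\<Sum>i\<in>I. gram_poly S (G i))"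
  by (induction I rule: infinite_finite_induct) (simp_all add: gram_poly_add, simp_all add: gram_poly_def)

lemma gram_poly_square:
  "gram_poly S (\<lambda>a b. c a * c b) = (\<Sum>a\<in>S. Poly_Mapping.single a (c a))\<^sup>2"
  by (simp add: gram_poly_def power2_eq_square sum_product mult_single)

lemma gram_poly_in_polynomials: "gram_poly (monomials n d) G \<in> polynomials n (2 * d)"
  unfolding gram_poly_def mult_2
  by (intro polynomials_sum polynomials_single monomials_add)

text \<open>Naming the sum of squares makes the existential in \<open>kDDSOS\<close> usable by unification.\<close>
definition ddsos_sum ::
    "nat \<Rightarrow> nat \<Rightarrow> nat \<Rightarrow> (monomial list \<Rightarrow> nat) \<Rightarrow> (monomial list \<Rightarrow> nat \<Rightarrow> monomial \<Rightarrow> real) \<Rightarrow> mpolynomial"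
  where "ddsos_sum k n d J \<alpha> = (\<Sum>ms | length ms = k \<and> set ms \<subseteq> monomials n d.
    \<Sum>j<J ms. (\<Sum>l<k. Poly_Mapping.single (ms ! l) (\<alpha> ms j (ms ! l)))\<^sup>2)"

lemma kDDSOS_iff: "kDDSOS k n d p \<longleftrightarrow> (\<exists>J \<alpha>. p = ddsos_sum k n d J \<alpha>)"
  by (simp add: kDDSOS_def ddsos_sum_def)

text \<open>A monomial that is repeated in the tuple contributes its coefficient once for each occurrence, so the
  vector of a square collects these contributions; it is supported on the monomials of the tuple.\<close>
lemma kDDSOS_imp_gram:
  assumes "kDDSOS k n d p"
  shows "p \<in> gram_poly (monomials n d) ` sparse_cone k (monomials n d)"
proof -
  obtain J \<alpha> where p: "p = ddsos_sum k n d J \<alpha>"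
    using assms(1) by (auto simp: kDDSOS_iff)
  define L where "L = {ms. length ms = k \<and> set ms \<subseteq> monomials n d}"
  define c where "c ms j m = (\<Sum>l<k. if ms ! l = m then \<alpha> ms j (ms ! l) else 0)" for ms j m
  have c: "(\<Sum>l<k. Poly_Mapping.single (ms ! l) (\<alpha> ms j (ms ! l)))
      = (\<Sum>m\<in>monomials n d. Poly_Mapping.single m (c ms j m))" if "ms \<in> L" for ms j
  proof -
    have "(\<Sum>m\<in>monomials n d. Poly_Mapping.single m (c ms j m))
        = (\<Sum>l<k. \<Sum>m\<in>monomials n d. if ms ! l = m then Poly_Mapping.single (ms ! l) (\<alpha> ms j (ms ! l)) else 0)"
      unfolding c_def single_sum by (subst sum.swap) (intro sum.cong refl, auto)
    also have "\<dots> = (\<Sum>l<k. Poly_Mapping.single (ms ! l) (\<alpha> ms j (ms ! l)))"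
      using that nth_mem by (intro sum.cong refl) (fastforce simp: L_def sum.delta' finite_monomials)
    finally show ?thesis ..
  qed
  have "p = gram_poly (monomials n d) (\<lambda>a b. \<Sum>ms\<in>L. \<Sum>j<J ms. c ms j a * c ms j b)"
    unfolding gram_poly_sum gram_poly_square p ddsos_sum_def by (simp add: c flip: L_def)
  moreover have "(\<lambda>a b. \<Sum>ms\<in>L. \<Sum>j<J ms. c ms j a * c ms j b) \<in> sparse_cone k (monomials n d)"
  proof (intro sparse_cone_sum)
    fix ms j assume ms: "ms \<in> L"
    show "(\<lambda>a b. c ms j a * c ms j b) \<in> sparse_cone k (monomials n d)"
    proof (rule sparse_cone_square[where A = "set ms"])
      show "card (set ms) \<le> k" using ms card_length[of ms] by (simp add: L_def)
      show "c ms j a = 0" if "a \<notin> set ms" for a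
        using that ms by (auto simp: c_def L_def intro!: sum.neutral)
    qed (use ms in \<open>auto simp: L_def\<close>)
  qed
  ultimately show ?thesis by blast
qed

lemma kDDSOS_add_square:
  assumes "kDDSOS k n d p" and ms: "length ms = k" "set ms \<subseteq> monomials n d"
  shows "kDDSOS k n d (p + (\<Sum>l<k. Poly_Mapping.single (ms ! l) (f (ms ! l)))\<^sup>2)"
proof -
  obtain J \<alpha> where p: "p = ddsos_sum k n d J \<alpha>"
    using assms(1) by (auto simp: kDDSOS_iff)
  define L where "L = {ms. length ms = k \<and> set ms \<subseteq> monomials n d}"
  have L: "finite L" "ms \<in> L"
    using finite_lists_length_eq[OF finite_monomials[of n d], of k] ms by (auto simp: L_def conj_commute)
  define J' where "J' = J(ms := Suc (J ms))"
  define \<alpha>' where "\<alpha>' = \<alpha>(ms := (\<alpha> ms)(J ms := f))"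
  have "(\<Sum>j<J' xs. (\<Sum>l<k. Poly_Mapping.single (xs ! l) (\<alpha>' xs j (xs ! l)))\<^sup>2)
      = (\<Sum>j<J xs. (\<Sum>l<k. Poly_Mapping.single (xs ! l) (\<alpha> xs j (xs ! l)))\<^sup>2)
        + (if xs = ms then (\<Sum>l<k. Poly_Mapping.single (ms ! l) (f (ms ! l)))\<^sup>2 else 0)" for xs
    by (auto simp: J'_def \<alpha>'_def intro!: sum.cong)
  then have "p + (\<Sum>l<k. Poly_Mapping.single (ms ! l) (f (ms ! l)))\<^sup>2
      = (\<Sum>xs\<in>L. \<Sum>j<J' xs. (\<Sum>l<k. Poly_Mapping.single (xs ! l) (\<alpha>' xs j (xs ! l)))\<^sup>2)"
    using L by (simp add: p ddsos_sum_def sum.distrib flip: L_def)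
  then show ?thesis unfolding kDDSOS_iff ddsos_sum_def L_def by blast
qed

text \<open>The support of each vector is listed as a tuple, padded to length \<open>k\<close> by repeating one of its
  monomials. The padding multiplies coefficients, hence the division by the number \<open>w m\<close> of
  occurrences.\<close>
lemma gram_imp_kDDSOS:
  assumes "1 \<le> k" and "G \<in> sparse_cone k (monomials n d)"
  shows "kDDSOS k n d (gram_poly (monomials n d) G)"
  using assms(2)
proof induction
  case zero
  have "ddsos_sum k n d (\<lambda>_. 0) \<alpha> = 0" for \<alpha> by (simp add: ddsos_sum_def)
  then show ?case by (auto simp: kDDSOS_iff gram_poly_def intro!: exI[of _ "\<lambda>_. 0"])
next
  case (add_square G A c)
  show ?case
  \<comment> \<open>only a nonempty support has a monomial to pad the tuple with\<close>
  proof (cases "A = {}")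
    case True
    then show ?thesis using add_square by simp
  next
    case False
    then obtain m0 where m0: "m0 \<in> A" by blast
    obtain as where as: "set as = A" "length as = card A"
      using finite_distinct_list[OF \<open>finite A\<close>] distinct_card by metis
    define ms where "ms = as @ replicate (k - card A) m0"
    have ms: "length ms = k" "set ms = A"
      using as m0 add_square.hyps(4) by (auto simp: ms_def)
    define w where "w m = card {l. l < k \<and> ms ! l = m}" for m
    have "(\<Sum>l<k. Poly_Mapping.single (ms ! l) (c (ms ! l) / real (w (ms ! l))))
        = (\<Sum>m\<in>A. \<Sum>l\<in>{l. l \<in> {..<k} \<and> ms ! l = m}. Poly_Mapping.single (ms ! l) (c (ms ! l) / real (w (ms ! l))))"
      using ms by (intro sum.group[symmetric]) (auto simp: add_square.hyps)
    also have "\<dots> = (\<Sum>m\<in>A. \<Sum>l\<in>{l. l < k \<and> ms ! l = m}. Poly_Mapping.single m (c m / real (w m)))"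
      by (intro sum.cong) auto
    also have "\<dots> = (\<Sum>m\<in>A. Poly_Mapping.single m (c m))"
    proof (intro sum.cong refl)
      fix m assume "m \<in> A"
      then have "{l. l < k \<and> ms ! l = m} \<noteq> {}" using ms by (auto simp: in_set_conv_nth)
      then have "w m \<noteq> 0" by (simp add: w_def)
      have "(\<Sum>l\<in>{l. l < k \<and> ms ! l = m}. Poly_Mapping.single m (c m / real (w m)))
          = Poly_Mapping.single m (\<Sum>l\<in>{l. l < k \<and> ms ! l = m}. c m / real (w m))"
        by (rule single_sum[symmetric])
      also have "\<dots> = Poly_Mapping.single m (c m)"
        using \<open>w m \<noteq> 0\<close> by (simp flip: w_def)
      finally show "(\<Sum>l\<in>{l. l < k \<and> ms ! l = m}. Poly_Mapping.single m (c m / real (w m)))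
        = Poly_Mapping.single m (c m)" .
    qed
    also have "\<dots> = (\<Sum>m\<in>monomials n d. Poly_Mapping.single m (c m))"
      using add_square.hyps by (intro sum.mono_neutral_left) (auto simp: finite_monomials)
    finally show ?thesis
      using kDDSOS_add_square[OF add_square.IH ms(1), of "\<lambda>m. c m / real (w m)"] ms(2) add_square.hyps(2)
      by (simp add: gram_poly_add gram_poly_square)
  qed
qed

lemma kSOS_eq_gram:
  "1 \<le> k \<Longrightarrow> kSOS k n d = gram_poly (monomials n d) ` sparse_cone k (monomials n d)"
  using kDDSOS_imp_gram gram_imp_kDDSOS gram_poly_in_polynomials by (fastforce simp: kSOS_def)

section \<open>Quadratic polynomials\<close>

abbreviation var :: "nat \<Rightarrow> monomial" where
  "var i \<equiv> Poly_Mapping.single i (Suc 0)"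

lemma var_eq_iff: "var a = var b \<longleftrightarrow> a = b"
  by (metis lookup_single_eq lookup_single_not_eq nat.distinct(1))

lemma var_neq_zero: "var a \<noteq> 0"
  by (metis lookup_single_eq lookup_zero nat.distinct(1))

lemma lookup_var_add: "Poly_Mapping.lookup (var a + m) a \<noteq> 0"
  by (simp add: lookup_add)

lemma lookup_var: "Poly_Mapping.lookup (var b) a \<noteq> 0 \<longleftrightarrow> a = b"
  by (auto simp: lookup_single when_def)

lemma var_add_neq: "var a + var b \<noteq> 0" "var a + var b \<noteq> var c"
proof -
  show "var a + var b \<noteq> 0" using lookup_var_add[of a "var b"] by fastforce
  show "var a + var b \<noteq> var c"
  proof
    assume eq: "var a + var b = var c"
    then have "a = c" using lookup_var_add[of a "var b"] by (simp only: lookup_var)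
    then show False using eq var_neq_zero[of b] by simp
  qed
qed

lemma var_add_eq_iff:
  "var a + var b = var a' + var b' \<longleftrightarrow> (a = a' \<and> b = b') \<or> (a = b' \<and> b = a')"
proof
  assume eq: "var a + var b = var a' + var b'"
  have "a = a' \<or> a = b'"
    using lookup_var_add[of a "var b"] lookup_var[of a' a] lookup_var[of b' a]
    unfolding eq lookup_add by auto
  then show "(a = a' \<and> b = b') \<or> (a = b' \<and> b = a')"
  proof
    assume "a = a'"
    then show ?thesis using eq by (simp add: var_eq_iff)
  next
    assume "a = b'"
    then have "var a + var b = var a + var a'" using eq by (simp only: add.commute)
    then show ?thesis using \<open>a = b'\<close> by (simp add: var_eq_iff)
  qed
qed (auto simp: add.commute)

lemma monomials_1: "monomials n 1 = insert 0 (var ` {..<n})"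
proof (rule antisym; rule subsetI)
  fix m assume m: "m \<in> monomials n 1"
  show "m \<in> insert 0 (var ` {..<n})"
  proof (cases "m = 0")
    case False
    then obtain i where i: "Poly_Mapping.lookup m i \<noteq> 0" by (metis lookup_zero poly_mapping_eqI)
    then have "i < n" using m by (auto simp: monomials_def in_keys_iff subset_iff)
    have "Poly_Mapping.lookup m i + (\<Sum>j\<in>{..<n} - {i}. Poly_Mapping.lookup m j) \<le> 1"
      using m \<open>i < n\<close> by (simp add: monomials_def sum.remove[of "{..<n}" i])
    then have "Poly_Mapping.lookup m i = Suc 0" "(\<Sum>j\<in>{..<n} - {i}. Poly_Mapping.lookup m j) = 0"
      using i by linarith+
    moreover have "Poly_Mapping.lookup m j = 0" if "j \<noteq> i" for j
    proof (cases "j < n")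
      case True
      then show ?thesis using calculation(2) that by simp
    next
      case False
      then have "j \<notin> Poly_Mapping.keys m" using m by (auto simp: monomials_def)
      then show ?thesis by (simp add: in_keys_iff)
    qed
    ultimately have "m = var i"
      by (intro poly_mapping_eqI) (metis lookup_single_eq lookup_single_not_eq)
    then show ?thesis using \<open>i < n\<close> by simp
  qed simp
qed (auto simp: monomials_def lookup_single when_def)

definition quadratic :: "nat \<Rightarrow> real \<Rightarrow> (nat \<Rightarrow> real) \<Rightarrow> (nat \<Rightarrow> nat \<Rightarrow> real) \<Rightarrow> mpolynomial" where
  "quadratic n w v H = Poly_Mapping.single 0 w + (\<Sum>i<n. Poly_Mapping.single (var i) (v i))
     + (\<Sum>a<n. \<Sum>b<n. Poly_Mapping.single (var a + var b) (H a b))"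

lemma gram_poly_monomials_1:
  "gram_poly (monomials n 1) G
   = quadratic n (G 0 0) (\<lambda>i. G 0 (var i) + G (var i) 0) (\<lambda>a b. G (var a) (var b))"
proof -
  have "0 \<notin> var ` {..<n}" using var_neq_zero by (metis imageE)
  moreover have "inj_on var {..<n}" by (simp add: inj_on_def var_eq_iff)
  ultimately show ?thesis
    unfolding gram_poly_def monomials_1 quadratic_def
    by (simp add: sum.reindex sum.distrib single_add add_ac)
qed

text \<open>Each monomial of degree two arises from \<open>H a b\<close> and \<open>H b a\<close> only, so the coefficients determine a
  symmetric \<open>H\<close>, as well as \<open>w\<close> and \<open>v\<close>.\<close>
lemma lookup_quadratic:
  "Poly_Mapping.lookup (quadratic n w v H) 0 = w"
  "i < n \<Longrightarrow> Poly_Mapping.lookup (quadratic n w v H) (var i) = v i"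
  "a < n \<Longrightarrow> b < n \<Longrightarrow> Poly_Mapping.lookup (quadratic n w v H) (var a + var b)
    = (if a = b then H a a else H a b + H b a)"
proof -
  note neq = var_add_neq var_neq_zero var_add_neq[symmetric] var_neq_zero[symmetric]
  show "Poly_Mapping.lookup (quadratic n w v H) 0 = w"
    by (simp add: quadratic_def lookup_add lookup_sum lookup_single neq when_def)
  show "Poly_Mapping.lookup (quadratic n w v H) (var i) = v i" if "i < n"
    using that by (simp add: quadratic_def lookup_add lookup_sum lookup_single neq var_eq_iff when_def)
  assume ab: "a < n" "b < n"
  have "Poly_Mapping.lookup (quadratic n w v H) (var a + var b)
      = (\<Sum>a'<n. \<Sum>b'<n. if (a' = a \<and> b' = b) \<or> (a' = b \<and> b' = a) then H a' b' else 0)"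
    by (simp add: quadratic_def lookup_add lookup_sum lookup_single neq when_def var_add_eq_iff)
  also have "\<dots> = (\<Sum>(a', b')\<in>{..<n} \<times> {..<n}. if (a' = a \<and> b' = b) \<or> (a' = b \<and> b' = a) then H a' b' else 0)"
    by (simp add: sum.cartesian_product)
  also have "\<dots> = (\<Sum>(a', b')\<in>{(a, b), (b, a)}. H a' b')"
    using ab by (intro sum.mono_neutral_cong_right) (auto split: if_splits)
  finally show "Poly_Mapping.lookup (quadratic n w v H) (var a + var b)
    = (if a = b then H a a else H a b + H b a)" by auto
qed

text \<open>In a Gram matrix \<open>G\<close> of the polynomial the entry at the constant monomial is the constant term, hence
  zero, and with it the whole row of the constant monomial. The linear terms come from this row alone, and
  the remaining entries of \<open>G\<close> must be those of \<open>H\<close>.\<close>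
lemma quadratic_in_kSOS_iff:
  assumes "1 \<le> k" and sym: "\<And>a b. H a b = H b a" and supp: "\<And>a b. \<not> a < n \<Longrightarrow> H a b = 0"
  shows "quadratic n 0 v H \<in> kSOS k n 1 \<longleftrightarrow> H \<in> sparse_cone k {..<n} \<and> (\<forall>i<n. v i = 0)"
proof safe
  assume "quadratic n 0 v H \<in> kSOS k n 1"
  then obtain G where G: "G \<in> sparse_cone k (monomials n 1)"
    and eq: "quadratic n 0 v H = gram_poly (monomials n 1) G"
    using kSOS_eq_gram[OF assms(1)] by auto
  note eq = eq[unfolded gram_poly_monomials_1]
  have G00: "G 0 0 = 0"
    using arg_cong[OF eq, of "\<lambda>p. Poly_Mapping.lookup p 0"] by (simp add: lookup_quadratic)
  then have G0: "G 0 m = 0" "G m 0 = 0" for m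
    using sparse_cone_diagonal[OF G, of 0 m] sparse_cone_sym[OF G, of m 0] by auto
  show "v i = 0" if "i < n" for i
    using that arg_cong[OF eq, of "\<lambda>p. Poly_Mapping.lookup p (var i)"] G0
    by (simp add: lookup_quadratic)
  have H: "H a b = G (var a) (var b)" if "a < n" "b < n" for a b
    using that arg_cong[OF eq, of "\<lambda>p. Poly_Mapping.lookup p (var a + var b)"]
      sym[of a b] sparse_cone_sym[OF G, of "var a" "var b"]
    by (auto simp: lookup_quadratic split: if_splits)
  have "(\<lambda>a b. if a \<in> {..<n} \<and> b \<in> {..<n} then G (var a) (var b) else 0) \<in> sparse_cone k {..<n}"
    by (rule sparse_cone_pullback[OF G]) (auto simp: inj_on_def var_eq_iff monomials_1[unfolded One_nat_def])
  then show "H \<in> sparse_cone k {..<n}"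
  proof (rule back_subst[where P = "\<lambda>H. H \<in> _"], intro ext)
    fix a b
    show "(if a \<in> {..<n} \<and> b \<in> {..<n} then G (var a) (var b) else 0) = H a b"
      using H[of a b] supp[of a b] supp[of b a] sym[of a b] by auto
  qed
next
  assume H: "H \<in> sparse_cone k {..<n}" and v: "\<forall>i<n. v i = 0"
  define idx where "idx m = (THE i. m = var i)" for m
  have idx: "idx (var i) = i" for i by (auto simp: idx_def var_eq_iff)
  define G where "G x y = (if x \<in> var ` {..<n} \<and> y \<in> var ` {..<n} then H (idx x) (idx y) else 0)" for x y
  have "G \<in> sparse_cone k (var ` {..<n})"
    unfolding G_def by (rule sparse_cone_pullback[OF H]) (auto simp: inj_on_def idx)
  then have "G \<in> sparse_cone k (monomials n 1)"
    by (rule sparse_cone_mono) (auto simp: monomials_1[unfolded One_nat_def])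
  moreover have "quadratic n 0 v H = gram_poly (monomials n 1) G"
  proof -
    have "0 \<notin> var ` {..<n}" using var_neq_zero by (metis imageE)
    then have "G 0 m = 0" "G m 0 = 0" for m by (auto simp: G_def)
    moreover have "G (var a) (var b) = H a b" if "a < n" "b < n" for a b
      using that by (auto simp: G_def idx)
    ultimately show ?thesis
      unfolding gram_poly_monomials_1 using v by (simp add: quadratic_def)
  qed
  ultimately show "quadratic n 0 v H \<in> kSOS k n 1"
    using kSOS_eq_gram[OF assms(1)] by blast
qed

section \<open>Affine data\<close>

text \<open>The data of a DDSOS program are coefficient polynomials \<open>R i t\<close>, and those of a cone program are
  matrices. Instead of computing one from the other, constraints are written as functions of the decision
  vector, and closure properties show that they are affine. The index \<open>0\<close> belongs to the constant part
  and \<open>i\<close> to the coordinate \<open>i - 1\<close>.\<close>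
definition affine_fun :: "nat \<Rightarrow> (real vec \<Rightarrow> real) \<Rightarrow> bool" where
  "affine_fun l \<phi> \<longleftrightarrow> (\<exists>c. \<forall>u\<in>carrier_vec l. \<phi> u = c 0 + (\<Sum>i=1..l. u $ (i - 1) * c i))"

lemma affine_fun_const: "affine_fun l (\<lambda>_. c)"
  unfolding affine_fun_def by (rule exI[of _ "\<lambda>i. if i = 0 then c else 0"]) auto

lemma affine_fun_coord: "i < l \<Longrightarrow> affine_fun l (\<lambda>u. u $ i)"
  unfolding affine_fun_def
  by (rule exI[of _ "\<lambda>j. if j = Suc i then 1 else 0"]) (auto simp: if_distrib cong: if_cong)

lemma affine_fun_add: "affine_fun l \<phi> \<Longrightarrow> affine_fun l \<psi> \<Longrightarrow> affine_fun l (\<lambda>u. \<phi> u + \<psi> u)"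
proof -
  assume "affine_fun l \<phi>" "affine_fun l \<psi>"
  then obtain c d where "\<forall>u\<in>carrier_vec l. \<phi> u = c 0 + (\<Sum>i=1..l. u $ (i - 1) * c i)"
    "\<forall>u\<in>carrier_vec l. \<psi> u = d 0 + (\<Sum>i=1..l. u $ (i - 1) * d i)"
    unfolding affine_fun_def by blast
  then show ?thesis unfolding affine_fun_def
    by (intro exI[of _ "\<lambda>i. c i + d i"]) (auto simp: sum.distrib algebra_simps)
qed

lemma affine_fun_cmult: "affine_fun l \<phi> \<Longrightarrow> affine_fun l (\<lambda>u. a * \<phi> u)"
proof -
  assume "affine_fun l \<phi>"
  then obtain c where "\<forall>u\<in>carrier_vec l. \<phi> u = c 0 + (\<Sum>i=1..l. u $ (i - 1) * c i)"
    unfolding affine_fun_def by blast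
  then show ?thesis unfolding affine_fun_def
    by (intro exI[of _ "\<lambda>i. a * c i"]) (auto simp: sum_distrib_left algebra_simps)
qed

lemma affine_fun_sum: "(\<And>i. i \<in> I \<Longrightarrow> affine_fun l (\<phi> i)) \<Longrightarrow> affine_fun l (\<lambda>u. \<Sum>i\<in>I. \<phi> i u)"
  by (induction I rule: infinite_finite_induct) (auto intro: affine_fun_const affine_fun_add)

lemma affine_fun_if:
  "(P \<Longrightarrow> affine_fun l \<phi>) \<Longrightarrow> (\<not> P \<Longrightarrow> affine_fun l \<psi>) \<Longrightarrow> affine_fun l (\<lambda>u. if P then \<phi> u else \<psi> u)"
  by (cases P) auto

lemma linear_fun_scalar_prod:
  assumes "affine_fun l \<phi>" "\<phi> (0\<^sub>v l) = 0"
  obtains r where "r \<in> carrier_vec l" "\<And>u. u \<in> carrier_vec l \<Longrightarrow> \<phi> u = r \<bullet> u"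
proof -
  obtain c where c: "\<And>u. u \<in> carrier_vec l \<Longrightarrow> \<phi> u = c 0 + (\<Sum>i=1..l. u $ (i - 1) * c i)"
    using assms(1) unfolding affine_fun_def by blast
  have "(\<Sum>i=1..l. 0\<^sub>v l $ (i - 1) * c i) = 0" by (intro sum.neutral) auto
  then have c0: "c 0 = 0" using c[of "0\<^sub>v l"] assms(2) by simp
  show ?thesis
  proof (rule that[of "vec l (\<lambda>i. c (Suc i))"])
    fix u :: "real vec" assume u: "u \<in> carrier_vec l"
    have "(\<Sum>i=1..l. u $ (i - 1) * c i) = (\<Sum>i<l. u $ i * c (Suc i))"
      by (simp add: sum.atLeast1_atMost_eq)
    then show "\<phi> u = vec l (\<lambda>i. c (Suc i)) \<bullet> u"
      using u by (simp add: c c0 scalar_prod_def lessThan_atLeast0 mult.commute)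
  qed simp
qed

definition affine_poly :: "nat \<Rightarrow> nat \<Rightarrow> nat \<Rightarrow> (real vec \<Rightarrow> mpolynomial) \<Rightarrow> bool" where
  "affine_poly l n D p \<longleftrightarrow> (\<exists>R. (\<forall>i\<le>l. R i \<in> polynomials n D) \<and>
     (\<forall>u\<in>carrier_vec l. p u = R 0 + (\<Sum>i=1..l. Poly_Mapping.single 0 (u $ (i - 1)) * R i)))"

lemma affine_poly_single:
  assumes "affine_fun l \<phi>" "m \<in> monomials n D"
  shows "affine_poly l n D (\<lambda>u. Poly_Mapping.single m (\<phi> u))"
proof -
  obtain c where "\<forall>u\<in>carrier_vec l. \<phi> u = c 0 + (\<Sum>i=1..l. u $ (i - 1) * c i)"
    using assms(1) unfolding affine_fun_def by blast
  then show ?thesis unfolding affine_poly_def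
    by (intro exI[of _ "\<lambda>i. Poly_Mapping.single m (c i)"])
      (auto simp: single_add single_sum mult_single polynomials_single assms(2))
qed

lemma affine_poly_add:
  assumes "affine_poly l n D p" "affine_poly l n D q"
  shows "affine_poly l n D (\<lambda>u. p u + q u)"
proof -
  obtain R where R: "\<forall>i\<le>l. R i \<in> polynomials n D"
    "\<forall>u\<in>carrier_vec l. p u = R 0 + (\<Sum>i=1..l. Poly_Mapping.single 0 (u $ (i - 1)) * R i)"
    using assms(1) unfolding affine_poly_def by blast
  obtain Q where Q: "\<forall>i\<le>l. Q i \<in> polynomials n D"
    "\<forall>u\<in>carrier_vec l. q u = Q 0 + (\<Sum>i=1..l. Poly_Mapping.single 0 (u $ (i - 1)) * Q i)"
    using assms(2) unfolding affine_poly_def by blast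
  show ?thesis unfolding affine_poly_def
    using R Q by (intro exI[of _ "\<lambda>i. R i + Q i"])
      (simp add: polynomials_add distrib_left sum.distrib add_ac)
qed

lemma affine_poly_zero: "affine_poly l n D (\<lambda>_. 0)"
  unfolding affine_poly_def by (rule exI[of _ "\<lambda>_. 0"]) (simp add: polynomials_zero)

lemma affine_poly_sum:
  "(\<And>i. i \<in> I \<Longrightarrow> affine_poly l n D (p i)) \<Longrightarrow> affine_poly l n D (\<lambda>u. \<Sum>i\<in>I. p i u)"
  by (induction I rule: infinite_finite_induct) (auto intro: affine_poly_zero affine_poly_add)

lemma affine_poly_quadratic:
  assumes "\<And>i. affine_fun l (\<lambda>u. v u i)" "\<And>a b. affine_fun l (\<lambda>u. H u a b)"
  shows "affine_poly l n 2 (\<lambda>u. quadratic n 0 (v u) (H u))"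
proof -
  have m: "0 \<in> monomials n 1" "\<And>i. i < n \<Longrightarrow> var i \<in> monomials n 1"
    unfolding monomials_1 by auto
  have 2: "a + b \<in> monomials n 2" if "a \<in> monomials n 1" "b \<in> monomials n 1" for a b
    using monomials_add[OF that] by (simp only: one_add_one)
  have "var i \<in> monomials n 2" if "i < n" for i using 2[OF m(1) m(2)[OF that]] by simp
  moreover have "0 \<in> monomials n 2" using 2[OF m(1) m(1)] by simp
  ultimately show ?thesis
    unfolding quadratic_def using assms 2 m
    by (intro affine_poly_add affine_poly_sum affine_poly_single affine_fun_const) auto
qed

section \<open>Cone programs as DDSOS programs\<close>

text \<open>The single constraint \<open>quadratic n 0 (v u) (H u) \<in> kSOS k n 1\<close> stands for a cone
  constraint together with \<open>n\<close> equations.\<close>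
lemma DDSOS_programI:
  fixes n :: nat
  assumes "1 \<le> k" "1 \<le> n" "r \<in> carrier_vec l"
    and affine: "\<And>i. affine_fun l (\<lambda>u. v u i)" "\<And>a b. affine_fun l (\<lambda>u. H u a b)"
    and H: "\<And>u a b. H u a b = H u b a" "\<And>u a b. \<not> a < n \<Longrightarrow> H u a b = 0"
  shows "\<lparr>vspace = module_vec TYPE(real) l,
     feasible = {u \<in> carrier_vec l. H u \<in> sparse_cone k {..<n} \<and> (\<forall>i<n. v u i = 0)},
     objective = (\<lambda>u. r \<bullet> u)\<rparr> \<in> DDSOS_programs k"
proof -
  obtain R where R: "\<forall>i\<le>l. R i \<in> polynomials n 2"
    "\<And>u. u \<in> carrier_vec l \<Longrightarrow> quadratic n 0 (v u) (H u)
      = R 0 + (\<Sum>i=1..l. Poly_Mapping.single 0 (u $ (i - 1)) * R i)"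
    using affine_poly_quadratic[of l v H n, OF affine] unfolding affine_poly_def by blast
  have "{u \<in> carrier_vec l. H u \<in> sparse_cone k {..<n} \<and> (\<forall>i<n. v u i = 0)}
      = {u \<in> carrier_vec l. R 0 + (\<Sum>i=1..l. Poly_Mapping.single 0 (u $ (i - 1)) * R i) \<in> kSOS k n 1}"
    using quadratic_in_kSOS_iff[OF assms(1) H] R(2)[symmetric] by auto
  then have "\<lparr>vspace = module_vec TYPE(real) l,
     feasible = {u \<in> carrier_vec l. H u \<in> sparse_cone k {..<n} \<and> (\<forall>i<n. v u i = 0)},
     objective = (\<lambda>u. r \<bullet> u)\<rparr> = DDSOS_program k l r 1 (\<lambda>_. n) (\<lambda>_. 1) (\<lambda>i _. R i)"
    unfolding DDSOS_program_def by simp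
  moreover have "\<dots> \<in> DDSOS_programs k"
    unfolding DDSOS_programs_def using assms R(1)
    by (intro CollectI exI conjI) (auto simp: numeral_2_eq_2)
  ultimately show ?thesis by simp
qed

definition entries :: "nat \<Rightarrow> real mat \<Rightarrow> nat \<Rightarrow> nat \<Rightarrow> real" where
  "entries d X a b = (if a < d \<and> b < d then X $$ (a, b) else 0)"

lemma sparse_cone_restrict:
  assumes "G \<in> sparse_cone k A" "B \<subseteq> A"
  shows "(\<lambda>a b. if a \<in> B \<and> b \<in> B then G a b else 0) \<in> sparse_cone k B"
  using sparse_cone_pullback[OF assms(1), of "\<lambda>x. x" B] assms(2) by simp

lemma in_psd_cone_iff:
  assumes "k \<le> d" "d \<le> n" "X \<in> carrier_mat d d"
  shows "X \<in> psd_cone k d \<longleftrightarrow> entries d X \<in> sparse_cone k {..<n}"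
proof
  assume "X \<in> psd_cone k d"
  then obtain G where G: "G \<in> sparse_cone k {..<d}" "X = mat d d (\<lambda>(a, b). G a b)"
    by (auto simp: psd_cone_eq_sparse_cone[OF assms(1)])
  have "entries d X = G"
    using sparse_cone_support[OF G(1)] by (auto simp: entries_def G(2) intro!: ext)
  then show "entries d X \<in> sparse_cone k {..<n}"
    using sparse_cone_mono[OF G(1), of "{..<n}"] assms(2) by simp
next
  assume "entries d X \<in> sparse_cone k {..<n}"
  then have "(\<lambda>a b. if a \<in> {..<d} \<and> b \<in> {..<d} then entries d X a b else 0) \<in> sparse_cone k {..<d}"
    by (rule sparse_cone_restrict) (use assms(2) in auto)
  moreover have "X = mat d d (\<lambda>(a, b). if a \<in> {..<d} \<and> b \<in> {..<d} then entries d X a b else 0)"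
    using assms(3) by (intro eq_matI) (auto simp: entries_def)
  ultimately show "X \<in> psd_cone k d"
    unfolding psd_cone_eq_sparse_cone[OF assms(1)] by blast
qed

lemma entries_sym: "X \<in> sym_mats d \<Longrightarrow> entries d X a b = entries d X b a"
  by (auto simp: entries_def sym_mats_index)

lemma cast_inequality_program:
  assumes "1 \<le> k" "k \<le> d" "P \<in> inequality_cone_programs k d"
  shows "\<exists>Q\<in>DDSOS_programs k. can_be_cast_into P Q"
proof -
  obtain n q M where P: "P = inequality_cone_program k d n q M" and q: "q \<in> carrier_vec n"
    and M: "\<And>i. i \<le> n \<Longrightarrow> M i \<in> sym_mats d"
    using assms(3) by (auto simp: inequality_cone_programs_def)
  define X where "X x = (\<Oplus>\<^bsub>module_mat TYPE(real) d d\<^esub>i\<in>{1..n}. (x $ (i - 1)) \<cdot>\<^sub>m M i) + M 0" for x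
  have MC: "M i \<in> carrier_mat d d" if "i \<le> n" for i using M[OF that] by (simp add: sym_mats_def)
  have smult: "i \<in> {1..n} \<Longrightarrow> (x $ (i - 1)) \<cdot>\<^sub>m M i \<in> carrier_mat d d" for i and x :: "real vec"
    using MC by simp
  have carr: "X x \<in> carrier_mat d d" for x
    using MC by (auto simp: X_def)
  have X: "X x $$ (a, b) = (\<Sum>i=1..n. x $ (i - 1) * M i $$ (a, b)) + M 0 $$ (a, b)"
    if "a < d" "b < d" for x a b
  proof -
    have "(\<Oplus>\<^bsub>module_mat TYPE(real) d d\<^esub>i\<in>{1..n}. (x $ (i - 1)) \<cdot>\<^sub>m M i) $$ (a, b)
        = (\<Sum>i=1..n. ((x $ (i - 1)) \<cdot>\<^sub>m M i) $$ (a, b))"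
      using that by (intro index_finsum_mat(2) smult) auto
    then have "X x $$ (a, b) = (\<Sum>i=1..n. ((x $ (i - 1)) \<cdot>\<^sub>m M i) $$ (a, b)) + M 0 $$ (a, b)"
      using that MC[of 0] unfolding X_def
      by (subst index_add_mat(1)) simp_all
    also have "(\<Sum>i=1..n. ((x $ (i - 1)) \<cdot>\<^sub>m M i) $$ (a, b)) = (\<Sum>i=1..n. x $ (i - 1) * M i $$ (a, b))"
    proof (intro sum.cong refl)
      fix i assume "i \<in> {1..n}"
      then have "M i \<in> carrier_mat d d" by (intro MC) simp
      then show "((x $ (i - 1)) \<cdot>\<^sub>m M i) $$ (a, b) = x $ (i - 1) * M i $$ (a, b)"
        using that by simp
    qed
    finally show ?thesis .
  qed
  have sym: "X x \<in> sym_mats d" for x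
    using carr by (intro sym_matsI) (auto simp: X sym_mats_index[OF M] intro!: sum.cong)
  let ?Q = "\<lparr>vspace = module_vec TYPE(real) n,
     feasible = {u \<in> carrier_vec n. entries d (X u) \<in> sparse_cone k {..<d} \<and> (\<forall>i<d. (0::real) = 0)},
     objective = (\<lambda>u. q \<bullet> u)\<rparr>"
  have "?Q \<in> DDSOS_programs k"
  proof (rule DDSOS_programI[where v = "\<lambda>_ _. 0"])
    have affX: "affine_fun n (\<lambda>u. X u $$ (a, b))" if "a < d" "b < d" for a b
    proof -
      have "affine_fun n (\<lambda>x. (\<Sum>i=1..n. M i $$ (a, b) * x $ (i - 1)) + M 0 $$ (a, b))"
        by (intro affine_fun_add affine_fun_sum affine_fun_cmult affine_fun_coord affine_fun_const) auto
      then show ?thesis using that by (simp add: X mult.commute)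
    qed
    show "affine_fun n (\<lambda>u. entries d (X u) a b)" for a b
      unfolding entries_def by (intro affine_fun_if affX affine_fun_const) auto
  qed (use assms q in \<open>auto simp: affine_fun_const entries_sym[OF sym], auto simp: entries_def\<close>)
  moreover have "can_be_cast_into P ?Q"
  proof -
    have "affine_map (module_vec TYPE(real) n) (module_vec TYPE(real) n) (\<lambda>x. x)"
      unfolding affine_map_def
      by (intro bexI[of _ "\<lambda>x. x"] bexI[of _ "0\<^sub>v n"])
        (auto simp: module_vec_simps LinearCombinations.module_hom_def)
    then show ?thesis
      unfolding can_be_cast_into_def P inequality_cone_program_def X_def[symmetric]
        in_psd_cone_iff[OF assms(2) order_refl carr]
      by (intro exI[of _ "\<lambda>x. x"]) simp
  qed
  ultimately show ?thesis by blast
qed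

lemma mat_trace_mult:
  assumes "A \<in> carrier_mat d d" "X \<in> carrier_mat d d"
  shows "mat_trace (A * X) = (\<Sum>a<d. \<Sum>b<d. A $$ (a, b) * X $$ (b, a))"
  using assms by (simp add: mat_trace_def scalar_prod_def lessThan_atLeast0)

text \<open>The equations of the program go into the linear terms. They need \<open>p\<close> variables and the quadratic form
  needs \<open>d\<close>; the two may share variables, and \<open>n = d + p\<close> is enough for both.\<close>
lemma cast_standard_program:
  assumes "1 \<le> k" "k \<le> d" "P \<in> standard_cone_programs k d"
  shows "\<exists>Q\<in>DDSOS_programs k. can_be_cast_into P Q"
proof -
  obtain p A b where P: "P = standard_cone_program k d p A b" and A: "\<And>i. i \<le> p \<Longrightarrow> A i \<in> sym_mats d"
    using assms(3) by (auto simp: standard_cone_programs_def)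
  define l where "l = d * d"
  define n where "n = d + p"
  have pos: "a * d + b < l" if "a < d" "b < d" for a b
  proof -
    have "a * d + b < Suc a * d" using that by simp
    also have "\<dots> \<le> d * d" using that by (intro mult_right_mono) auto
    finally show ?thesis by (simp add: l_def)
  qed
  define X where "X u = mat d d (\<lambda>(a, b). (u $ (a * d + b) + u $ (b * d + a)) / 2)" for u :: "real vec"
  have X: "X u $$ (a, b) = 1/2 * u $ (a * d + b) + 1/2 * u $ (b * d + a)" if "a < d" "b < d" for u a b
    using that by (simp add: X_def add_divide_distrib)
  have carr: "X u \<in> carrier_mat d d" for u by (simp add: X_def)
  have sym: "X u \<in> sym_mats d" for u using carr by (intro sym_matsI) (auto simp: X)
  have AC: "A i \<in> carrier_mat d d" if "i \<le> p" for i using A[OF that] by (simp add: sym_mats_def)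
  have affX: "affine_fun l (\<lambda>u. X u $$ (a, b))" if "a < d" "b < d" for a b
    unfolding X[OF that] using that pos
    by (intro affine_fun_add affine_fun_cmult affine_fun_coord) auto
  have afftr: "affine_fun l (\<lambda>u. mat_trace (A i * X u))" if "i \<le> p" for i
    unfolding mat_trace_mult[OF AC[OF that] carr]
    by (intro affine_fun_sum affine_fun_cmult affX) auto
  have "mat_trace (A 0 * X (0\<^sub>v l)) = 0"
    unfolding mat_trace_mult[OF AC[OF le0] carr] by (auto simp: X pos intro!: sum.neutral)
  then obtain r where r: "r \<in> carrier_vec l" "\<And>u. u \<in> carrier_vec l \<Longrightarrow> mat_trace (A 0 * X u) = r \<bullet> u"
    using linear_fun_scalar_prod[OF afftr[OF le0]] by blast
  define v where "v u i = (if i < p then mat_trace (A (Suc i) * X u) - b (Suc i) else 0)" for u i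
  let ?F = "{u \<in> carrier_vec l. entries d (X u) \<in> sparse_cone k {..<n} \<and> (\<forall>i<n. v u i = 0)}"
  let ?Q = "\<lparr>vspace = module_vec TYPE(real) l, feasible = ?F, objective = (\<lambda>u. r \<bullet> u)\<rparr>"
  have "?Q \<in> DDSOS_programs k"
  proof (rule DDSOS_programI)
    show "affine_fun l (\<lambda>u. v u i)" for i
    proof (cases "i < p")
      case True
      then have "affine_fun l (\<lambda>u. mat_trace (A (Suc i) * X u) + - b (Suc i))"
        by (intro affine_fun_add afftr affine_fun_const) auto
      then show ?thesis using True by (simp add: v_def)
    qed (simp add: v_def affine_fun_const)
    show "affine_fun l (\<lambda>u. entries d (X u) a b)" for a b
      unfolding entries_def by (intro affine_fun_if affX affine_fun_const) auto
  qed (use assms r in \<open>auto simp: entries_sym[OF sym] n_def, auto simp: entries_def\<close>)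
  moreover have "can_be_cast_into P ?Q"
  proof -
    \<comment> \<open>the constant part of the affine map \<open>X\<close> is zero\<close>
    have hom: "X \<in> LinearCombinations.module_hom class_ring (module_vec TYPE(real) l) (sym_space d)"
      unfolding LinearCombinations.module_hom_def
    proof (intro CollectI conjI allI impI)
      show "X \<in> carrier (module_vec TYPE(real) l) \<rightarrow> carrier (sym_space d)"
        using sym by (simp add: sym_space_def)
    next
      fix u w assume "u \<in> carrier (module_vec TYPE(real) l) \<and> w \<in> carrier (module_vec TYPE(real) l)"
      then have "dim_vec u = l" "dim_vec w = l" by (auto simp: module_vec_simps)
      then show "X (u \<oplus>\<^bsub>module_vec TYPE(real) l\<^esub> w) = X u \<oplus>\<^bsub>sym_space d\<^esub> X w"
        using carr by (intro eq_matI)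
          (simp_all add: sym_space_def module_vec_simps module_mat_simps X pos carrier_matD[OF carr] add_divide_distrib)
    next
      fix c :: real and u
      assume "c \<in> carrier class_ring \<and> u \<in> carrier (module_vec TYPE(real) l)"
      then have "dim_vec u = l" by (auto simp: module_vec_simps)
      then show "X (c \<odot>\<^bsub>module_vec TYPE(real) l\<^esub> u) = c \<odot>\<^bsub>sym_space d\<^esub> X u"
        using carr by (intro eq_matI)
          (simp_all add: sym_space_def module_vec_simps module_mat_simps X pos carrier_matD[OF carr] distrib_left)
    qed
    have "affine_map (module_vec TYPE(real) l) (sym_space d) X"
      unfolding affine_map_def
      by (intro bexI[OF _ hom] bexI[of _ "0\<^sub>m d d"])
        (auto simp: sym_space_def module_mat_simps right_add_zero_mat[OF carr] intro!: sym_matsI)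
    moreover have surj: "\<exists>u\<in>carrier_vec l. Y = X u" if Y: "Y \<in> sym_mats d" for Y
    proof
      define u where "u = vec l (\<lambda>i. Y $$ (i div d, i mod d))"
      show "u \<in> carrier_vec l" by (simp add: u_def)
      have "u $ (a * d + b) = Y $$ (a, b)" if "a < d" "b < d" for a b
        using that pos[OF that] by (simp add: u_def)
      then show "Y = X u"
        using Y sym_mats_index[OF Y] by (intro eq_matI) (auto simp: X_def sym_mats_def)
    qed
    have feas: "(\<forall>i<n. v u i = 0) \<longleftrightarrow> (\<forall>i\<in>{1..p}. mat_trace (A i * X u) = b i)" for u
      unfolding image_Suc_lessThan[symmetric] by (auto simp: v_def n_def)
    have cone: "X u \<in> psd_cone k d \<longleftrightarrow> entries d (X u) \<in> sparse_cone k {..<n}" for u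
      by (rule in_psd_cone_iff[OF assms(2) _ carr]) (simp add: n_def)
    have "X ` ?F = {X \<in> sym_mats d. (\<forall>i\<in>{1..p}. mat_trace (A i * X) = b i) \<and> X \<in> psd_cone k d}"
      unfolding feas cone[symmetric] using sym surj by blast
    ultimately show ?thesis
      unfolding can_be_cast_into_def P standard_cone_program_def
      using r(2) by (intro exI[of _ X]) auto
  qed
  ultimately show ?thesis by blast
qed

section \<open>DDSOS programs as cone programs\<close>

text \<open>Linear functionals on symmetric matrices in the shape required by programs in standard form. The closure
  properties avoid writing down the data matrices, which have to be symmetric.\<close>
definition trace_form :: "nat \<Rightarrow> (real mat \<Rightarrow> real) \<Rightarrow> bool" where
  "trace_form d \<phi> \<longleftrightarrow> (\<exists>A\<in>sym_mats d. \<forall>X\<in>sym_mats d. \<phi> X = mat_trace (A * X))"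

lemma trace_form_iff:
  "trace_form d \<phi> \<longleftrightarrow> (\<exists>A\<in>sym_mats d. \<forall>X\<in>sym_mats d.
     \<phi> X = (\<Sum>a<d. \<Sum>b<d. A $$ (a, b) * X $$ (b, a)))"
  unfolding trace_form_def
  by (intro bex_cong ball_cong refl) (auto simp: sym_mats_def mat_trace_mult)

lemma trace_form_entry:
  assumes ab: "a < d" "b < d"
  shows "trace_form d (\<lambda>X. X $$ (a, b))"
proof -
  define c where "c i j = (if i = a \<and> j = b then 1/2 else 0) + (if i = b \<and> j = a then 1/2 else (0::real))" for i j
  define A where "A = mat d d (\<lambda>(i, j). c i j)"
  have "c i j = c j i" for i j by (simp add: c_def conj_commute add.commute)
  then have "A \<in> sym_mats d" by (intro sym_matsI) (simp_all add: A_def)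
  moreover have "X $$ (a, b) = (\<Sum>i<d. \<Sum>j<d. A $$ (i, j) * X $$ (j, i))"
    if X: "X \<in> sym_mats d" for X
  proof -
    have "A $$ (i, j) * X $$ (j, i) = (if i = a \<and> j = b then X $$ (j, i) / 2 else 0)
        + (if i = b \<and> j = a then X $$ (j, i) / 2 else 0)" if "i < d" "j < d" for i j
    proof -
      have "A $$ (i, j) = c i j" using that by (simp add: A_def)
      then show ?thesis by (simp only: c_def) (simp only: distrib_right if_distrib[of "\<lambda>x. x * _"] mult_zero_left mult_1_left times_divide_eq_left)
    qed
    then have "(\<Sum>i<d. \<Sum>j<d. A $$ (i, j) * X $$ (j, i))
        = (\<Sum>i<d. \<Sum>j<d. (if i = a \<and> j = b then X $$ (j, i) / 2 else 0)
            + (if i = b \<and> j = a then X $$ (j, i) / 2 else 0))"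
      by (intro sum.cong refl) (simp only: lessThan_iff)
    also have "\<dots> = X $$ (b, a) / 2 + X $$ (a, b) / 2"
      by (simp only: sum.distrib, subst sum_sum_delta[OF ab], subst sum_sum_delta[OF ab(2,1)], rule refl)
    finally show ?thesis using sym_mats_index[OF X ab] by simp
  qed
  ultimately show ?thesis unfolding trace_form_iff by blast
qed

lemma trace_form_add:
  assumes "trace_form d \<phi>" "trace_form d \<psi>"
  shows "trace_form d (\<lambda>X. \<phi> X + \<psi> X)"
proof -
  obtain A B where A: "A \<in> sym_mats d" "\<forall>X\<in>sym_mats d. \<phi> X = (\<Sum>a<d. \<Sum>b<d. A $$ (a, b) * X $$ (b, a))"
    and B: "B \<in> sym_mats d" "\<forall>X\<in>sym_mats d. \<psi> X = (\<Sum>a<d. \<Sum>b<d. B $$ (a, b) * X $$ (b, a))"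
    using assms unfolding trace_form_iff by blast
  have "A \<in> carrier_mat d d" "B \<in> carrier_mat d d" using A B by (auto simp: sym_mats_def)
  then show ?thesis
    unfolding trace_form_iff using A B
    by (intro bexI[of _ "A + B"]) (auto simp: sym_mats_index distrib_right sum.distrib intro!: sym_matsI)
qed

lemma trace_form_cmult:
  assumes "trace_form d \<phi>"
  shows "trace_form d (\<lambda>X. c * \<phi> X)"
proof -
  obtain A where A: "A \<in> sym_mats d" "\<forall>X\<in>sym_mats d. \<phi> X = (\<Sum>a<d. \<Sum>b<d. A $$ (a, b) * X $$ (b, a))"
    using assms unfolding trace_form_iff by blast
  have "A \<in> carrier_mat d d" using A by (auto simp: sym_mats_def)
  then show ?thesis
    unfolding trace_form_iff using A
    by (intro bexI[of _ "c \<cdot>\<^sub>m A"]) (auto simp: sym_mats_index sum_distrib_left mult.assoc intro!: sym_matsI)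
qed

lemma trace_form_diff: "trace_form d \<phi> \<Longrightarrow> trace_form d \<psi> \<Longrightarrow> trace_form d (\<lambda>X. \<phi> X - \<psi> X)"
  using trace_form_add[of d \<phi> "\<lambda>X. - 1 * \<psi> X"] trace_form_cmult[of d \<psi> "-1"] by simp

lemma trace_form_zero: "trace_form d (\<lambda>_. 0)"
  unfolding trace_form_iff by (rule bexI[of _ "0\<^sub>m d d"]) (auto intro!: sym_matsI sum.neutral)

lemma trace_form_sum: "(\<And>i. i \<in> I \<Longrightarrow> trace_form d (\<phi> i)) \<Longrightarrow> trace_form d (\<lambda>X. \<Sum>i\<in>I. \<phi> i X)"
  by (induction I rule: infinite_finite_induct) (auto intro: trace_form_zero trace_form_add)

lemma standard_cone_programI:
  assumes c: "trace_form d c" and C: "finite C" "\<And>i. i \<in> C \<Longrightarrow> trace_form d (\<phi> i)"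
  obtains Q where "Q \<in> standard_cone_programs k d" "vspace Q = sym_space d"
    "feasible Q = {X \<in> sym_mats d. (\<forall>i\<in>C. \<phi> i X = \<beta> i) \<and> X \<in> psd_cone k d}"
    "\<And>X. X \<in> sym_mats d \<Longrightarrow> objective Q X = c X"
proof -
  obtain g where g: "bij_betw g {1..card C} C"
    using ex_bij_betw_nat_finite_1[OF C(1)] by blast
  have "\<exists>A. i \<le> card C \<longrightarrow> A \<in> sym_mats d \<and>
      (\<forall>X\<in>sym_mats d. (if i = 0 then c X else \<phi> (g i) X) = mat_trace (A * X))" for i
  proof (cases "i = 0")
    case True
    then show ?thesis using c unfolding trace_form_def by auto
  next
    case False
    have "g i \<in> C" if "i \<le> card C" using False that g by (auto simp: bij_betw_def)
    then show ?thesis using C(2)[of "g i"] False unfolding trace_form_def by auto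
  qed
  then obtain A where A: "\<And>i. i \<le> card C \<Longrightarrow> A i \<in> sym_mats d"
    "\<And>i X. i \<le> card C \<Longrightarrow> X \<in> sym_mats d \<Longrightarrow> (if i = 0 then c X else \<phi> (g i) X) = mat_trace (A i * X)"
    by metis
  show ?thesis
  proof (rule that[of "standard_cone_program k d (card C) A (\<lambda>i. \<beta> (g i))"])
    show "standard_cone_program k d (card C) A (\<lambda>i. \<beta> (g i)) \<in> standard_cone_programs k d"
      unfolding standard_cone_programs_def using A(1) by blast
    have "(\<forall>i\<in>{1..card C}. mat_trace (A i * X) = \<beta> (g i)) \<longleftrightarrow> (\<forall>i\<in>C. \<phi> i X = \<beta> i)"
      if X: "X \<in> sym_mats d" for X
    proof -
      have "mat_trace (A i * X) = \<phi> (g i) X" if "i \<in> {1..card C}" for i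
        using A(2)[of i X] X that by auto
      then have "(\<forall>i\<in>{1..card C}. mat_trace (A i * X) = \<beta> (g i)) \<longleftrightarrow> (\<forall>i\<in>{1..card C}. \<phi> (g i) X = \<beta> (g i))"
        by (intro ball_cong refl) simp
      also have "\<dots> \<longleftrightarrow> (\<forall>i\<in>g ` {1..card C}. \<phi> i X = \<beta> i)" by blast
      finally show ?thesis unfolding bij_betw_imp_surj_on[OF g] .
    qed
    then show "feasible (standard_cone_program k d (card C) A (\<lambda>i. \<beta> (g i)))
      = {X \<in> sym_mats d. (\<forall>i\<in>C. \<phi> i X = \<beta> i) \<and> X \<in> psd_cone k d}"
      unfolding standard_cone_program_def by auto
    show "objective (standard_cone_program k d (card C) A (\<lambda>i. \<beta> (g i))) X = c X"
      if "X \<in> sym_mats d" for X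
      using A(2)[OF _ that, of 0] by (simp add: standard_cone_program_def)
  qed (simp add: standard_cone_program_def)
qed

text \<open>The rows of \<open>X\<close> are labelled by \<open>Inl (t, m)\<close> for a monomial \<open>m\<close> of the constraint \<open>t\<close>, and by
  \<open>Inr (i, True)\<close> and \<open>Inr (i, False)\<close> for the positive and the negative part of the
  variable \<open>u\<^sub>i\<close>. The injection \<open>h\<close> numbers the labels.\<close>
lemma cast_DDSOS_program:
  assumes "1 \<le> k" "P \<in> DDSOS_programs k"
  shows "\<exists>D\<ge>k. \<exists>Q\<in>standard_cone_programs k D. can_be_cast_into P Q"
proof -
  obtain l r T n d R where P: "P = DDSOS_program k l r T n d R" and r: "r \<in> carrier_vec l"
    and R: "\<And>t i. t \<in> {1..T} \<Longrightarrow> i \<le> l \<Longrightarrow> R i t \<in> polynomials (n t) (2 * d t)"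
    using assms(2) by (auto simp: DDSOS_programs_def)
  define Mon where "Mon t = monomials (n t) (d t)" for t
  define I :: "((nat \<times> monomial) + (nat \<times> bool)) set"
    where "I = Inl ` Sigma {1..T} Mon \<union> Inr ` ({..<l} \<times> UNIV)"
  have "finite I" by (auto simp: I_def Mon_def finite_monomials)
  then obtain h where h: "bij_betw h I {0..<card I}" using ex_bij_betw_finite_nat by blast
  then have inj: "inj_on h I" by (simp add: bij_betw_def)
  \<comment> \<open>the \<open>k\<close> surplus rows ensure that the order of the matrices is at least \<open>k\<close>\<close>
  define D where "D = card I + k"
  have hD: "h ` I \<subseteq> {..<D}" using h by (auto simp: bij_betw_def D_def)
  have hD': "h x < D" if "x \<in> I" for x using hD that by auto
  define f where "f X = vec l (\<lambda>i. X $$ (h (Inr (i, True)), h (Inr (i, True)))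
    - X $$ (h (Inr (i, False)), h (Inr (i, False))))" for X :: "real mat"
  define block where "block t X a b = X $$ (h (Inl (t, a)), h (Inl (t, b)))" for t and X :: "real mat" and a b
  define p where "p t u = R 0 t + (\<Sum>i=1..l. Poly_Mapping.single 0 (u $ (i - 1)) * R i t)" for t and u :: "real vec"
  have p: "p t u \<in> polynomials (n t) (2 * d t)" if "t \<in> {1..T}" for t u
    unfolding p_def using R[OF that]
    by (intro polynomials_add polynomials_sum polynomials_const_mult) auto
  define C where "C = Sigma {1..T} (\<lambda>t. monomials (n t) (2 * d t))"
  \<comment> \<open>the equation labelled \<open>(t, m)\<close> compares the coefficients of \<open>m\<close> in the two sides of constraint \<open>t\<close>\<close>
  define \<phi> where "\<phi> = (\<lambda>(t, m) X. Poly_Mapping.lookup (gram_poly (Mon t) (block t X)) m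
    - (\<Sum>i=1..l. Poly_Mapping.lookup (R i t) m * f X $ (i - 1)))"
  define \<beta> where "\<beta> = (\<lambda>(t, m). Poly_Mapping.lookup (R 0 t) m)"
  have tf: "trace_form D (\<lambda>X. f X $ i)" if "i < l" for i
    unfolding f_def using that by (auto simp: I_def intro!: trace_form_diff trace_form_entry hD')
  have "trace_form D (\<phi> c)" if "c \<in> C" for c
  proof -
    obtain t m where c: "c = (t, m)" "t \<in> {1..T}" using \<open>c \<in> C\<close> by (auto simp: C_def)
    have "trace_form D (\<lambda>X. if Q then block t X a b else 0)" if "a \<in> Mon t" "b \<in> Mon t" for Q a b
      unfolding block_def using that c
      by (cases Q) (auto simp: I_def intro!: trace_form_zero trace_form_entry hD')
    then show ?thesis
      unfolding c \<phi>_def prod.case lookup_gram_poly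
      by (intro trace_form_diff trace_form_sum trace_form_cmult tf) auto
  qed
  moreover have "trace_form D (\<lambda>X. \<Sum>i<l. r $ i * f X $ i)"
    by (intro trace_form_sum trace_form_cmult tf) auto
  moreover have "finite C" by (auto simp: C_def finite_monomials)
  ultimately obtain Q where Q: "Q \<in> standard_cone_programs k D" "vspace Q = sym_space D"
    "feasible Q = {X \<in> sym_mats D. (\<forall>c\<in>C. \<phi> c X = \<beta> c) \<and> X \<in> psd_cone k D}"
    "\<And>X. X \<in> sym_mats D \<Longrightarrow> objective Q X = (\<Sum>i<l. r $ i * f X $ i)"
    using standard_cone_programI[of D "\<lambda>X. \<Sum>i<l. r $ i * f X $ i" C \<phi> k \<beta>] by blast
  have constraint: "(\<forall>c\<in>C. \<phi> c X = \<beta> c) \<longleftrightarrow> (\<forall>t\<in>{1..T}. gram_poly (Mon t) (block t X) = p t (f X))" for X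
  proof -
    have lookup_p: "Poly_Mapping.lookup (p t u) m
        = Poly_Mapping.lookup (R 0 t) m + (\<Sum>i=1..l. Poly_Mapping.lookup (R i t) m * u $ (i - 1))" for t u m
      by (simp add: p_def lookup_add lookup_sum lookup_const_mult) (simp add: mult.commute)
    have "gram_poly (Mon t) (block t X) = p t (f X) \<longleftrightarrow>
        (\<forall>m\<in>monomials (n t) (2 * d t). Poly_Mapping.lookup (gram_poly (Mon t) (block t X)) m
          = Poly_Mapping.lookup (p t (f X)) m)" (is "_ \<longleftrightarrow> ?R") if t: "t \<in> {1..T}" for t
    proof
      assume ?R
      show "gram_poly (Mon t) (block t X) = p t (f X)"
      proof (rule poly_mapping_eqI)
        fix m
        show "Poly_Mapping.lookup (gram_poly (Mon t) (block t X)) m = Poly_Mapping.lookup (p t (f X)) m"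
          using \<open>?R\<close> lookup_outside_polynomials[OF p[OF t], of m]
            lookup_outside_polynomials[OF gram_poly_in_polynomials, of m]
          unfolding Mon_def by (cases "m \<in> monomials (n t) (2 * d t)") auto
      qed
    qed simp
    then show ?thesis
      unfolding C_def \<phi>_def \<beta>_def by (auto simp: lookup_p algebra_simps)
  qed
  have feas: "feasible P = {u \<in> carrier_vec l. \<forall>t\<in>{1..T}. p t u \<in> kSOS k (n t) (d t)}"
    by (simp add: P DDSOS_program_def p_def)
  have "can_be_cast_into P Q"
    unfolding can_be_cast_into_def
  proof (intro exI conjI)
    show "affine_map (vspace Q) (vspace P) f"
    proof -
      have "f \<in> LinearCombinations.module_hom class_ring (sym_space D) (module_vec TYPE(real) l)"
        unfolding LinearCombinations.module_hom_def
        by (auto simp: sym_space_def sym_mats_def module_mat_simps module_vec_simps f_def I_def hD'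
            algebra_simps intro!: eq_vecI)
      then show ?thesis
        unfolding affine_map_def Q(2) P DDSOS_program_def
        by (auto simp: module_vec_simps f_def intro!: bexI[of _ f] bexI[of _ "0\<^sub>v l"])
    qed
    show "\<forall>X\<in>feasible Q. objective P (f X) = objective Q X"
      by (auto simp: Q(3,4) P DDSOS_program_def scalar_prod_def f_def lessThan_atLeast0)
    show "f ` feasible Q = feasible P"
    proof (intro antisym subsetI)
      fix u assume "u \<in> f ` feasible Q"
      then obtain X where X: "X \<in> sym_mats D" "X \<in> psd_cone k D" "u = f X"
        and eq: "\<And>t. t \<in> {1..T} \<Longrightarrow> gram_poly (Mon t) (block t X) = p t (f X)"
        using constraint Q(3) by auto
      have X': "entries D X \<in> sparse_cone k {..<D}"
        using X(2) in_psd_cone_iff[of k D D X] X(1) by (simp add: D_def sym_mats_def)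
      have "p t u \<in> kSOS k (n t) (d t)" if t: "t \<in> {1..T}" for t
      proof -
        let ?h = "\<lambda>a. h (Inl (t, a))"
        let ?G = "\<lambda>a b. if a \<in> Mon t \<and> b \<in> Mon t then entries D X (?h a) (?h b) else 0"
        have I: "Inl (t, a) \<in> I" if "a \<in> Mon t" for a using that t by (auto simp: I_def)
        have "?G \<in> sparse_cone k (Mon t)"
          using I inj hD' by (intro sparse_cone_pullback[OF X']) (auto simp: inj_on_def)
        moreover have "p t u = gram_poly (Mon t) ?G"
          unfolding X(3) eq[OF t, symmetric]
          by (intro gram_poly_cong) (auto simp: block_def entries_def hD' I)
        ultimately show ?thesis unfolding kSOS_eq_gram[OF assms(1)] Mon_def by blast
      qed
      then show "u \<in> feasible P" by (simp add: feas X(3) f_def)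
    next
      fix u assume "u \<in> feasible P"
      then have u: "u \<in> carrier_vec l" and "\<forall>t\<in>{1..T}. \<exists>G. G \<in> sparse_cone k (Mon t) \<and> p t u = gram_poly (Mon t) G"
        unfolding feas kSOS_eq_gram[OF assms(1)] Mon_def by auto
      then obtain G where G: "\<And>t. t \<in> {1..T} \<Longrightarrow> G t \<in> sparse_cone k (Mon t)"
        "\<And>t. t \<in> {1..T} \<Longrightarrow> p t u = gram_poly (Mon t) (G t)"
        using bchoice by metis
      \<comment> \<open>\<open>K\<close> is block diagonal, with blocks \<open>G t\<close> and the positive and negative parts of \<open>u\<close>\<close>
      define B where "B t x y = (if x \<in> Inl ` ({t} \<times> Mon t) \<and> y \<in> Inl ` ({t} \<times> Mon t)
        then G t (snd (projl x)) (snd (projl y)) else 0)" for t and x y :: "(nat \<times> monomial) + (nat \<times> bool)"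
      have B: "B t \<in> sparse_cone k I" if t: "t \<in> {1..T}" for t
      proof -
        have "B t \<in> sparse_cone k (Inl ` ({t} \<times> Mon t))"
          unfolding B_def by (rule sparse_cone_pullback[OF G(1)[OF t]]) (auto simp: inj_on_def)
        then show ?thesis by (rule sparse_cone_mono) (use t in \<open>auto simp: I_def\<close>)
      qed
      define w where "w = (\<lambda>(i, s). sqrt (max 0 (if s then u $ i else - u $ i)))"
      define E where "E z x y = (if x = Inr z then w z else 0) * (if y = Inr z then w z else 0)"
        for z and x y :: "(nat \<times> monomial) + (nat \<times> bool)"
      have E: "E z \<in> sparse_cone k I" if "z \<in> {..<l} \<times> UNIV" for z
        unfolding E_def using assms(1) that
        by (intro sparse_cone_square[where A = "{Inr z}"]) (auto simp: I_def)
      define K where "K x y = (\<Sum>t\<in>{1..T}. B t x y) + (\<Sum>z\<in>{..<l} \<times> UNIV. E z x y)" for x y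
      have K: "K \<in> sparse_cone k I"
        unfolding K_def by (intro sparse_cone_add sparse_cone_sum B E)
      have K_block: "K (Inl (t, a)) (Inl (t, b)) = G t a b" if "t \<in> {1..T}" "a \<in> Mon t" "b \<in> Mon t" for t a b
      proof -
        have "B t' (Inl (t, a)) (Inl (t, b)) = (if t' = t then G t a b else 0)" for t'
          using that by (auto simp: B_def)
        then show ?thesis using that by (simp add: K_def E_def)
      qed
      have K_diag: "K (Inr z) (Inr z) = (w z)\<^sup>2" if "z \<in> {..<l} \<times> UNIV" for z
      proof -
        have "B t (Inr z) (Inr z) = 0" for t by (auto simp: B_def)
        moreover have "E z' (Inr z) (Inr z) = (if z' = z then (w z)\<^sup>2 else 0)" for z'
          by (auto simp: E_def power2_eq_square)
        ultimately show ?thesis using that by (simp add: K_def)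
      qed
      define h' where "h' = the_inv_into I h"
      have h': "h' (h x) = x" if "x \<in> I" for x
        unfolding h'_def by (rule the_inv_into_f_f[OF inj that])
      define H where "H x y = (if x \<in> h ` I \<and> y \<in> h ` I then K (h' x) (h' y) else 0)" for x y
      have "H \<in> sparse_cone k (h ` I)"
        unfolding H_def by (rule sparse_cone_pullback[OF K]) (auto simp: inj_on_def h')
      then have H: "H \<in> sparse_cone k {..<D}" using hD by (rule sparse_cone_mono)
      define X where "X = mat D D (\<lambda>(a, b). H a b)"
      have XK: "X $$ (h x, h y) = K x y" if "x \<in> I" "y \<in> I" for x y
        using that by (simp add: X_def H_def hD' h')
      have "X \<in> psd_cone k D"
        using H psd_cone_eq_sparse_cone[of k D] by (auto simp: X_def D_def)
      moreover have "X \<in> sym_mats D"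
        using sparse_cone_sym[OF H] by (intro sym_matsI) (auto simp: X_def)
      moreover have fX: "f X = u"
        using u by (intro eq_vecI) (auto simp: f_def XK K_diag I_def w_def)
      moreover have "gram_poly (Mon t) (block t X) = p t (f X)" if "t \<in> {1..T}" for t
        unfolding fX G(2)[OF that] using that
        by (intro gram_poly_cong) (auto simp: block_def XK K_block I_def)
      ultimately show "u \<in> f ` feasible Q"
        using constraint unfolding Q(3) by (intro image_eqI[of _ _ X]) auto
    qed
  qed
  then show ?thesis using Q(1) by (intro exI[of _ D]) (auto simp: D_def)
qed

theorem theorem4p5:
  fixes k :: nat
  assumes "k \<ge> 1"
  shows "(\<forall>P\<in>DDSOS_programs k. \<exists>d\<ge>k.
            (\<exists>Q\<in>standard_cone_programs k d. can_be_cast_into P Q) \<or>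
            (\<exists>Q\<in>inequality_cone_programs k d. can_be_cast_into P Q)) \<and>
         (\<forall>d\<ge>k.
            (\<forall>P\<in>standard_cone_programs k d. \<exists>Q\<in>DDSOS_programs k. can_be_cast_into P Q) \<and>
            (\<forall>P\<in>inequality_cone_programs k d. \<exists>Q\<in>DDSOS_programs k. can_be_cast_into P Q))"
  using cast_DDSOS_program[OF assms] cast_standard_program[OF assms] cast_inequality_program[OF assms]
  by blast

end
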